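(* Let $\mathcal{V}_F$ be the basic Fraenkel model and let $\mathfrak{m}$ denote the cardinality of its set of atoms $A$. Then in the model $\mathcal{V}_F$ the following hold: (1) $\operatorname{fin}(\mathfrak{m})\parallel \operatorname{seq}^{1\text{-}1}(\mathfrak{m})$; (2) $\operatorname{fin}(\mathfrak{m})\parallel \operatorname{seq}(\mathfrak{m})$; (3) $\operatorname{seq}^{1\text{-}1}(\mathfrak{m})\parallel 2^{\mathfrak{m}}$; (4) $\operatorname{seq}(\mathfrak{m})\parallel 2^{\mathfrak{m}}$.
   Context: Permutation models: work in a model of ZFA + AC (set theory with atoms) with set of atoms $A$, and let $\mathcal{G}$ be a group of permutations of $A$; each $\pi\in\mathcal{G}$ extends uniquely to an $\in$-automorphism of the universe, also written $\pi$. For $E\subseteq A$ let $\operatorname{fix}_{\mathcal{G}}(E)=\{\pi\in\mathcal{G}:\pi a=a\text{ for all }a\in E\}$ and for an object $x$ let $\operatorname{sym}_{\mathcal{G}}(x)=\{\pi\in\mathcal{G}:\pi x=x\}$. With the normal ideal $I_{\mathrm{fin}}$ of finite subsets of $A$, an object $x$ is symmetric if there is a finite $E\subseteq A$ (a support of $x$) with $\operatorname{fix}_{\mathcal{G}}(E)\subseteq\operatorname{sym}_{\mathcal{G}}(x)$. The permutation model is the class of all hereditarily symmetric objects; it is a transitive model of ZFA. The basic Fraenkel model $\mathcal{V}_F$ is the permutation model obtained when $A$ is countably infinite, $\mathcal{G}$ is the group of all permutations of $A$, and the ideal is $I_{\mathrm{fin}}$. Cardinal relations in $\mathcal{V}_F$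 are computed using functions belonging to $\mathcal{V}_F$: $\mathfrak{p}\le\mathfrak{q}$ iff there is in the model an injection from a set of cardinality $\mathfrak{p}$ into a set of cardinality $\mathfrak{q}$; $\mathfrak{p}\parallel\mathfrak{q}$ means neither $\mathfrak{p}\le\mathfrak{q}$ nor $\mathfrak{q}\le\mathfrak{p}$. For a set $m$ of cardinality $\mathfrak{m}$ (all computed in the model): $\operatorname{fin}(\mathfrak{m})$ is the cardinality of the set of finite subsets of $m$; $\operatorname{seq}^{1\text{-}1}(\mathfrak{m})$ that of the set of finite sequences of elements of $m$ without repetition; $\operatorname{seq}(\mathfrak{m})$ that of the set of all finite sequences of elements of $m$; $2^{\mathfrak{m}}$ that of the power set of $m$. *)

theory Defs
  imports Main
begin

section \<open>Structures for the language of set theory with atoms\<close>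

text \<open>
  A structure interprets a membership relation \<open>el\<close> and a constant \<open>atoms\<close> (the set \<open>A\<close> of
  atoms) on the carrier \<open>univ\<close>. Nothing here assumes that \<open>el\<close> is well-founded in the
  meta-logic: models are arbitrary first-order models, and all set-theoretic notions are
  evaluated inside a structure, with every quantifier ranging over its carrier. Applying the
  same notion to a smaller carrier therefore gives its relativization to a class.
\<close>

record 'u zf_structure =
  univ :: "'u set"
  el :: "'u \<Rightarrow> 'u \<Rightarrow> bool"
  atoms :: 'u

definition elts :: "('u, 'm) zf_structure_scheme \<Rightarrow> 'u \<Rightarrow> 'u set" where
  "elts M x = {z \<in> univ M. el M z x}"

definition is_set :: "('u, 'm) zf_structure_scheme \<Rightarrow> 'u \<Rightarrow> bool" where
  "is_set M x \<longleftrightarrow> x \<in> univ M \<and> x \<notin> elts M (atoms M)"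


subsection \<open>First-order formulas\<close>

text \<open>Variables are named by natural numbers; \<open>FAtoms i\<close> is the formula \<open>x\<^sub>i = A\<close>.\<close>

datatype fm = FMem nat nat | FEq nat nat | FAtoms nat | FNot fm | FAnd fm fm | FAll nat fm

primrec sat :: "('u, 'm) zf_structure_scheme \<Rightarrow> fm \<Rightarrow> (nat \<Rightarrow> 'u) \<Rightarrow> bool" where
  "sat M (FMem i j) s \<longleftrightarrow> el M (s i) (s j)"
| "sat M (FEq i j) s \<longleftrightarrow> s i = s j"
| "sat M (FAtoms i) s \<longleftrightarrow> s i = atoms M"
| "sat M (FNot \<phi>) s \<longleftrightarrow> \<not> sat M \<phi> s"
| "sat M (FAnd \<phi> \<psi>) s \<longleftrightarrow> sat M \<phi> s \<and> sat M \<psi> s"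
| "sat M (FAll i \<phi>) s \<longleftrightarrow> (\<forall>x\<in>univ M. sat M \<phi> (s(i := x)))"


subsection \<open>Basic set-theoretic notions inside a structure\<close>

definition is_empty :: "('u, 'm) zf_structure_scheme \<Rightarrow> 'u \<Rightarrow> bool" where
  "is_empty M x \<longleftrightarrow> is_set M x \<and> elts M x = {}"

definition is_upair :: "('u, 'm) zf_structure_scheme \<Rightarrow> 'u \<Rightarrow> 'u \<Rightarrow> 'u \<Rightarrow> bool" where
  "is_upair M a b c \<longleftrightarrow> is_set M c \<and> elts M c = {a, b}"

definition is_pair :: "('u, 'm) zf_structure_scheme \<Rightarrow> 'u \<Rightarrow> 'u \<Rightarrow> 'u \<Rightarrow> bool" where
  "is_pair M a b p \<longleftrightarrow>
    (\<exists>c\<in>univ M. \<exists>d\<in>univ M. is_upair M a a c \<and> is_upair M a b d \<and> is_upair M c d p)"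

definition is_succ :: "('u, 'm) zf_structure_scheme \<Rightarrow> 'u \<Rightarrow> 'u \<Rightarrow> bool" where
  "is_succ M n k \<longleftrightarrow> is_set M k \<and> elts M k = insert n (elts M n)"

definition is_inductive :: "('u, 'm) zf_structure_scheme \<Rightarrow> 'u \<Rightarrow> bool" where
  "is_inductive M w \<longleftrightarrow> is_set M w \<and> (\<exists>e\<in>elts M w. is_empty M e) \<and>
    (\<forall>n\<in>elts M w. \<exists>k\<in>elts M w. is_succ M n k)"

definition is_omega :: "('u, 'm) zf_structure_scheme \<Rightarrow> 'u \<Rightarrow> bool" where
  "is_omega M w \<longleftrightarrow> is_inductive M w \<and> (\<forall>v. is_inductive M v \<longrightarrow> elts M w \<subseteq> elts M v)"

text \<open>Possibly nonstandard natural numbers, i.e. the elements of the structure's own \<open>\<omega>\<close>.\<close>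

definition is_nat :: "('u, 'm) zf_structure_scheme \<Rightarrow> 'u \<Rightarrow> bool" where
  "is_nat M n \<longleftrightarrow> (\<exists>w. is_omega M w \<and> n \<in> elts M w)"

definition app :: "('u, 'm) zf_structure_scheme \<Rightarrow> 'u \<Rightarrow> 'u \<Rightarrow> 'u \<Rightarrow> bool" where
  "app M f x y \<longleftrightarrow> (\<exists>p\<in>elts M f. is_pair M x y p)"

definition is_fun :: "('u, 'm) zf_structure_scheme \<Rightarrow> 'u \<Rightarrow> 'u \<Rightarrow> 'u \<Rightarrow> bool" where
  "is_fun M f x y \<longleftrightarrow> is_set M f \<and>
    (\<forall>p\<in>elts M f. \<exists>u\<in>elts M x. \<exists>v\<in>elts M y. is_pair M u v p) \<and>
    (\<forall>u\<in>elts M x. \<exists>!v. app M f u v)"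

definition is_inj :: "('u, 'm) zf_structure_scheme \<Rightarrow> 'u \<Rightarrow> 'u \<Rightarrow> 'u \<Rightarrow> bool" where
  "is_inj M f x y \<longleftrightarrow> is_fun M f x y \<and> (\<forall>u u' v. app M f u v \<and> app M f u' v \<longrightarrow> u = u')"

definition is_bij :: "('u, 'm) zf_structure_scheme \<Rightarrow> 'u \<Rightarrow> 'u \<Rightarrow> 'u \<Rightarrow> bool" where
  "is_bij M f x y \<longleftrightarrow> is_inj M f x y \<and> (\<forall>v\<in>elts M y. \<exists>u. app M f u v)"

definition is_finite :: "('u, 'm) zf_structure_scheme \<Rightarrow> 'u \<Rightarrow> bool" where
  "is_finite M x \<longleftrightarrow> is_set M x \<and> (\<exists>n f. is_nat M n \<and> is_bij M f n x)"

definition is_countably_infinite :: "('u, 'm) zf_structure_scheme \<Rightarrow> 'u \<Rightarrow> bool" where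
  "is_countably_infinite M x \<longleftrightarrow> is_set M x \<and> (\<exists>w f. is_omega M w \<and> is_bij M f w x)"


section \<open>Models of ZFA with choice\<close>

text \<open>Separation and replacement are the first-order schemas, with parameters.\<close>

definition ZFA_AC :: "('u, 'm) zf_structure_scheme \<Rightarrow> bool" where
  "ZFA_AC M \<longleftrightarrow>
    \<comment> \<open>atoms\<close>
    atoms M \<in> univ M \<and> (\<forall>a\<in>elts M (atoms M). elts M a = {}) \<and>
    \<comment> \<open>extensionality\<close>
    (\<forall>x y. is_set M x \<and> is_set M y \<and> elts M x = elts M y \<longrightarrow> x = y) \<and>
    \<comment> \<open>pairing\<close>
    (\<forall>a\<in>univ M. \<forall>b\<in>univ M. \<exists>c. is_upair M a b c) \<and>
    \<comment> \<open>union\<close>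
    (\<forall>x\<in>univ M. \<exists>u. is_set M u \<and> elts M u = (\<Union>y\<in>elts M x. elts M y)) \<and>
    \<comment> \<open>power set\<close>
    (\<forall>x\<in>univ M. \<exists>p. is_set M p \<and> elts M p = {y. is_set M y \<and> elts M y \<subseteq> elts M x}) \<and>
    \<comment> \<open>infinity\<close>
    (\<exists>w. is_inductive M w) \<and>
    \<comment> \<open>separation\<close>
    (\<forall>\<phi> s. (\<forall>i. s i \<in> univ M) \<longrightarrow>
      (\<forall>x\<in>univ M. \<exists>y. is_set M y \<and> elts M y = {z \<in> elts M x. sat M \<phi> (s(0 := z))})) \<and>
    \<comment> \<open>replacement\<close>
    (\<forall>\<phi> s. (\<forall>i. s i \<in> univ M) \<longrightarrow>
      (\<forall>x\<in>univ M.
        (\<forall>u\<in>elts M x. \<forall>v\<in>univ M. \<forall>v'\<in>univ M.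
          sat M \<phi> (s(0 := u, 1 := v)) \<and> sat M \<phi> (s(0 := u, 1 := v')) \<longrightarrow> v = v') \<longrightarrow>
        (\<exists>y. is_set M y \<and>
          elts M y = {v \<in> univ M. \<exists>u\<in>elts M x. sat M \<phi> (s(0 := u, 1 := v))}))) \<and>
    \<comment> \<open>foundation\<close>
    (\<forall>x\<in>univ M. elts M x \<noteq> {} \<longrightarrow> (\<exists>y\<in>elts M x. elts M y \<inter> elts M x = {})) \<and>
    \<comment> \<open>choice\<close>
    (\<forall>x\<in>univ M.
      (\<forall>y\<in>elts M x. elts M y \<noteq> {}) \<and>
      (\<forall>y\<in>elts M x. \<forall>y'\<in>elts M x. y \<noteq> y' \<longrightarrow> elts M y \<inter> elts M y' = {}) \<longrightarrow>
      (\<exists>c. is_set M c \<and> (\<forall>y\<in>elts M x. \<exists>!z. z \<in> elts M y \<inter> elts M c)))"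


section \<open>Permutation models\<close>

definition is_perm :: "('u, 'm) zf_structure_scheme \<Rightarrow> 'u \<Rightarrow> bool" where
  "is_perm M p \<longleftrightarrow> is_bij M p (atoms M) (atoms M)"

text \<open>
  An \<open>\<in>\<close>-automorphism of the universe is a class function of the structure, i.e. definable with
  parameters. Without definability the extension of a permutation need not be unique, as an
  ill-founded structure may have further automorphisms, which it cannot see.
\<close>

definition definable_fun :: "('u, 'm) zf_structure_scheme \<Rightarrow> ('u \<Rightarrow> 'u) \<Rightarrow> bool" where
  "definable_fun M h \<longleftrightarrow> (\<exists>\<phi> s. (\<forall>i. s i \<in> univ M) \<and>
    (\<forall>x\<in>univ M. \<forall>y\<in>univ M. h x = y \<longleftrightarrow> sat M \<phi> (s(0 := x, 1 := y))))"

definition is_aut :: "('u, 'm) zf_structure_scheme \<Rightarrow> ('u \<Rightarrow> 'u) \<Rightarrow> bool" where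
  "is_aut M h \<longleftrightarrow> definable_fun M h \<and> bij_betw h (univ M) (univ M) \<and>
    (\<forall>x\<in>univ M. \<forall>y\<in>univ M. el M (h x) (h y) \<longleftrightarrow> el M x y)"

definition extends_perm :: "('u, 'm) zf_structure_scheme \<Rightarrow> 'u \<Rightarrow> ('u \<Rightarrow> 'u) \<Rightarrow> bool" where
  "extends_perm M p h \<longleftrightarrow> is_aut M h \<and> (\<forall>a\<in>elts M (atoms M). app M p a (h a))"

text \<open>The value at \<open>x\<close> of the unique automorphism extending the permutation \<open>p\<close>.\<close>

definition act :: "('u, 'm) zf_structure_scheme \<Rightarrow> 'u \<Rightarrow> 'u \<Rightarrow> 'u" where
  "act M p x = (THE y. \<exists>h. extends_perm M p h \<and> h x = y)"

text \<open>Below, \<open>G\<close> is a group of permutations of the atoms, given as a class of the structure.\<close>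

definition fix_grp :: "('u, 'm) zf_structure_scheme \<Rightarrow> 'u set \<Rightarrow> 'u \<Rightarrow> 'u set" where
  "fix_grp M G e = {p \<in> G. \<forall>a\<in>elts M e. act M p a = a}"

definition sym_grp :: "('u, 'm) zf_structure_scheme \<Rightarrow> 'u set \<Rightarrow> 'u \<Rightarrow> 'u set" where
  "sym_grp M G x = {p \<in> G. act M p x = x}"

definition is_symmetric :: "('u, 'm) zf_structure_scheme \<Rightarrow> 'u set \<Rightarrow> 'u \<Rightarrow> bool" where
  "is_symmetric M G x \<longleftrightarrow>
    (\<exists>e. is_finite M e \<and> elts M e \<subseteq> elts M (atoms M) \<and> fix_grp M G e \<subseteq> sym_grp M G x)"

definition is_transitive :: "('u, 'm) zf_structure_scheme \<Rightarrow> 'u \<Rightarrow> bool" where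
  "is_transitive M t \<longleftrightarrow> is_set M t \<and> (\<forall>z\<in>elts M t. elts M z \<subseteq> elts M t)"

text \<open>The members of the transitive closure of \<open>{x}\<close>; in particular \<open>x\<close> itself.\<close>

definition tc_elts :: "('u, 'm) zf_structure_scheme \<Rightarrow> 'u \<Rightarrow> 'u set" where
  "tc_elts M x = {z \<in> univ M. \<forall>t. is_transitive M t \<and> x \<in> elts M t \<longrightarrow> z \<in> elts M t}"

definition hereditarily_symmetric ::
    "('u, 'm) zf_structure_scheme \<Rightarrow> 'u set \<Rightarrow> 'u \<Rightarrow> bool" where
  "hereditarily_symmetric M G x \<longleftrightarrow> x \<in> univ M \<and> (\<forall>z\<in>tc_elts M x. is_symmetric M G z)"

text \<open>The permutation model given by \<open>G\<close> and the ideal of finite sets of atoms.\<close>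

definition permutation_model ::
    "('u, 'm) zf_structure_scheme \<Rightarrow> 'u set \<Rightarrow> ('u, 'm) zf_structure_scheme" where
  "permutation_model M G = M\<lparr>univ := {x. hereditarily_symmetric M G x}\<rparr>"

text \<open>This is the basic Fraenkel model if the atoms of \<open>M\<close> are countably infinite in \<open>M\<close>.\<close>

definition fraenkel_model :: "('u, 'm) zf_structure_scheme \<Rightarrow> ('u, 'm) zf_structure_scheme" where
  "fraenkel_model M = permutation_model M {p. is_perm M p}"


section \<open>Cardinal relations inside a structure\<close>

definition card_le :: "('u, 'm) zf_structure_scheme \<Rightarrow> 'u \<Rightarrow> 'u \<Rightarrow> bool" where
  "card_le M x y \<longleftrightarrow> (\<exists>f. is_inj M f x y)"

definition card_incomparable :: "('u, 'm) zf_structure_scheme \<Rightarrow> 'u \<Rightarrow> 'u \<Rightarrow> bool" where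
  "card_incomparable M x y \<longleftrightarrow> \<not> card_le M x y \<and> \<not> card_le M y x"

text \<open>
  The following say that \<open>y\<close> is, in the structure, the set of finite subsets of \<open>m\<close>, of finite
  sequences in \<open>m\<close> without repetition, of finite sequences in \<open>m\<close>, and of subsets of \<open>m\<close>.
  By extensionality there is at most one such \<open>y\<close>.
\<close>

definition is_Fin :: "('u, 'm) zf_structure_scheme \<Rightarrow> 'u \<Rightarrow> 'u \<Rightarrow> bool" where
  "is_Fin M m y \<longleftrightarrow> is_set M y \<and> elts M y = {x. is_finite M x \<and> elts M x \<subseteq> elts M m}"

definition is_Seq11 :: "('u, 'm) zf_structure_scheme \<Rightarrow> 'u \<Rightarrow> 'u \<Rightarrow> bool" where
  "is_Seq11 M m y \<longleftrightarrow> is_set M y \<and> elts M y = {s. \<exists>n. is_nat M n \<and> is_inj M s n m}"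

definition is_Seq :: "('u, 'm) zf_structure_scheme \<Rightarrow> 'u \<Rightarrow> 'u \<Rightarrow> bool" where
  "is_Seq M m y \<longleftrightarrow> is_set M y \<and> elts M y = {s. \<exists>n. is_nat M n \<and> is_fun M s n m}"

definition is_Pow :: "('u, 'm) zf_structure_scheme \<Rightarrow> 'u \<Rightarrow> 'u \<Rightarrow> bool" where
  "is_Pow M m y \<longleftrightarrow> is_set M y \<and> elts M y = {x. is_set M x \<and> elts M x \<subseteq> elts M m}"

end

theory Submission
  imports Defs
begin

text \<open>
  Every relation in the statement follows from two facts about the Fraenkel model \<open>N\<close>. Suppose
  that \<open>Fin \<subseteq> Pow\<close> and \<open>Seq11 \<subseteq> Seq\<close> are the four sets formed over the atoms. Then no injection
  in \<open>N\<close> maps a superset of \<open>Fin\<close> into \<open>Seq\<close>, and none maps a superset of \<open>Seq11\<close> into \<open>Pow\<close>.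

  Both are proved with transpositions. Let \<open>F\<close> be an injection with finite support \<open>e\<close>, so that
  every transposition of atoms outside \<open>e\<close> maps \<open>F\<close> to itself.
  If \<open>F\<close> maps finite sets to sequences, take a finite set \<open>x\<close> containing two atoms \<open>a\<close>, \<open>b\<close>
  outside \<open>e\<close>. The transposition \<open>(a b)\<close> fixes \<open>x\<close>, hence the sequence \<open>F x\<close>, so \<open>b\<close> does not occur
  in \<open>F x\<close>. For a fresh atom \<open>c\<close>, also \<open>(b c)\<close> fixes \<open>F x\<close>, hence it fixes \<open>x\<close>, which is absurd
  because \<open>x\<close> contains \<open>b\<close> and omits \<open>c\<close>.
  If \<open>F\<close> maps sequences without repetition to sets of atoms, take a sequence \<open>s\<close> in which three
  atoms outside \<open>e\<close> occur. Two of them lie both inside or both outside the set \<open>F s\<close>, so their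
  transposition fixes \<open>F s\<close>, hence \<open>s\<close>, although it moves an entry of \<open>s\<close>.
  These are \<open>no_inj_Fin_Seq\<close> and \<open>no_inj_Seq11_Pow\<close>.

  Most of the work lies in making this meaningful in an arbitrary structure \<open>M\<close>, whose membership
  relation may be ill-founded when seen from outside. Induction over the natural numbers of \<open>M\<close> or
  over membership is then available for predicates definable in \<open>M\<close> only. Definability is
  therefore a predicate \<open>definable\<close> on meta-level predicates with one closure rule for each
  logical connective, and a proof of definability retraces the syntax of the formula.
  On this basis the action of a permutation is constructed by recursion over membership
  (\<open>lift_unique\<close>, \<open>lift_total\<close>) and is shown to preserve all definable predicates
  (\<open>definable_act\<close>). Since \<open>N\<close> is transitive and contains all finite sequences of atoms, finiteness,
  sequences and injections mean the same in \<open>N\<close> as in \<open>M\<close>, so that the two arguments above can be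
  carried out in \<open>M\<close>.

  An enumeration \<open>f\<close> of the atoms by \<open>\<omega>\<close> in \<open>M\<close> simplifies supports: every finite set of atoms
  lies in an initial segment \<open>f[k]\<close> (\<open>finite_bounded\<close>), so that supports may be taken of this form,
  and \<open>f[k + 2]\<close> and the restriction of \<open>f\<close> to \<open>k + 3\<close> serve as the finite set \<open>x\<close> and the
  sequence \<open>s\<close>.
\<close>

section \<open>Definability with parameters\<close>

text \<open>
  Bound variables are renamed along with the free ones. For injective \<open>r\<close> no variable is captured,
  and then renaming amounts to composing the environment with \<open>r\<close>.
\<close>

primrec rename :: "(nat \<Rightarrow> nat) \<Rightarrow> fm \<Rightarrow> fm" where
  "rename r (FMem i j) = FMem (r i) (r j)"
| "rename r (FEq i j) = FEq (r i) (r j)"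
| "rename r (FAtoms i) = FAtoms (r i)"
| "rename r (FNot \<phi>) = FNot (rename r \<phi>)"
| "rename r (FAnd \<phi> \<psi>) = FAnd (rename r \<phi>) (rename r \<psi>)"
| "rename r (FAll i \<phi>) = FAll (r i) (rename r \<phi>)"

lemma sat_rename:
  assumes "inj r"
  shows "sat M (rename r \<phi>) s \<longleftrightarrow> sat M \<phi> (s \<circ> r)"
proof (induction \<phi> arbitrary: s)
  case (FAll i \<phi>)
  have "s(r i := x) \<circ> r = (s \<circ> r)(i := x)" for x
    using assms by (auto simp: fun_eq_iff inj_eq)
  then show ?case by (simp only: rename.simps sat.simps FAll.IH)
qed (auto simp: assms inj_eq)

text \<open>
  Free variables sit at the even positions of an environment and parameters at the odd ones. Both
  supplies are infinite, so there is always room for another parameter or bound variable.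
\<close>

definition mix :: "(nat \<Rightarrow> 'u) \<Rightarrow> (nat \<Rightarrow> 'u) \<Rightarrow> nat \<Rightarrow> 'u" where
  "mix s e i = (if even i then s (i div 2) else e (i div 2))"

lemma mix_even [simp]: "mix s e (2 * i) = s i"
  and mix_odd [simp]: "mix s e (Suc (2 * i)) = e i"
  and mix_0 [simp]: "mix s e 0 = s 0"
  by (auto simp: mix_def)

locale zfa =
  fixes M :: "'u zf_structure"
  assumes ZFA: "ZFA_AC M"
begin

abbreviation "U \<equiv> univ M"
abbreviation "E \<equiv> elts M"
abbreviation "At \<equiv> atoms M"

lemma At_U [simp]: "At \<in> U"
  using ZFA by (simp add: ZFA_AC_def)

definition env :: "(nat \<Rightarrow> 'u) \<Rightarrow> bool" where
  "env s \<longleftrightarrow> (\<forall>i. s i \<in> U)"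

text \<open>
  The set of atoms is always admitted as a parameter. It is fixed by all automorphisms considered
  below, and its presence makes the set of parameters nonempty.
\<close>

definition params :: "'u set \<Rightarrow> 'u set" where
  "params C = insert At (C \<inter> U)"

text \<open>
  Definability by a formula with parameters from \<open>C\<close>. The choice \<open>C = UNIV\<close> serves separation and
  replacement. Small \<open>C\<close> serve invariance: a predicate that is definable from \<open>C\<close> is preserved by
  every automorphism that fixes the members of \<open>C\<close>.
\<close>

definition definable :: "'u set \<Rightarrow> ((nat \<Rightarrow> 'u) \<Rightarrow> bool) \<Rightarrow> bool" where
  "definable C P \<longleftrightarrow> (\<exists>\<phi> e. (\<forall>i. e i \<in> params C) \<and> (\<forall>s. env s \<longrightarrow> P s = sat M \<phi> (mix s e)))"

definition var_or_par :: "'u set \<Rightarrow> ((nat \<Rightarrow> 'u) \<Rightarrow> 'u) \<Rightarrow> bool" where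
  "var_or_par C t \<longleftrightarrow> (\<exists>i. t = (\<lambda>s. s i)) \<or> (\<exists>c\<in>params C. t = (\<lambda>s. c))"

lemma params_U: "c \<in> params C \<Longrightarrow> c \<in> U"
  by (auto simp: params_def)

lemma env_U [simp]: "env s \<Longrightarrow> s i \<in> U"
  by (simp add: env_def)

lemma var_or_par_U: "var_or_par C t \<Longrightarrow> env s \<Longrightarrow> t s \<in> U"
  by (auto simp: var_or_par_def params_U)

lemma var_or_par_var: "var_or_par C (\<lambda>s. s i)"
  by (auto simp: var_or_par_def)

lemma var_or_par_const: "c \<in> C \<Longrightarrow> c \<in> U \<Longrightarrow> var_or_par C (\<lambda>s. c)"
  by (auto simp: var_or_par_def params_def)

lemma var_or_par_At: "var_or_par C (\<lambda>s. At)"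
  by (auto simp: var_or_par_def params_def)

text \<open>
  Below a quantifier the variables move up by one position, as with de Bruijn indices.
\<close>

lemma var_or_par_shift: "var_or_par C t \<Longrightarrow> var_or_par C (\<lambda>s. t (\<lambda>i. s (Suc i)))"
  by (auto simp: var_or_par_def)

lemma definable_cong: "(\<And>s. env s \<Longrightarrow> P s = Q s) \<Longrightarrow> definable C Q \<Longrightarrow> definable C P"
  unfolding definable_def by metis

text \<open>
  Two formulas can be given the same parameters: the two parameter lists are interleaved and the
  variables renamed accordingly.
\<close>

lemma definable_merge:
  assumes "definable C P" "definable C Q"
  obtains \<phi> \<psi> e where "\<forall>i. e i \<in> params C"
    "\<And>s. env s \<Longrightarrow> P s = sat M \<phi> (mix s e)" "\<And>s. env s \<Longrightarrow> Q s = sat M \<psi> (mix s e)"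
proof -
  obtain \<phi> a where a: "\<forall>i. a i \<in> params C" "\<And>s. env s \<Longrightarrow> P s = sat M \<phi> (mix s a)"
    using assms(1) unfolding definable_def by blast
  obtain \<psi> b where b: "\<forall>i. b i \<in> params C" "\<And>s. env s \<Longrightarrow> Q s = sat M \<psi> (mix s b)"
    using assms(2) unfolding definable_def by blast
  define r q :: "nat \<Rightarrow> nat" where
    "r i = (if even i then i else 2 * i - 1)" and "q i = (if even i then i else 2 * i + 1)" for i
  have "even x \<Longrightarrow> odd y \<Longrightarrow> x \<noteq> 2 * y - 1" "even x \<Longrightarrow> odd y \<Longrightarrow> x \<noteq> 2 * y + 1" for x y :: nat
    by presburger+
  then have "inj r" "inj q"
    by (auto simp: inj_def r_def q_def elim!: oddE)
  moreover have "mix s (mix a b) \<circ> r = mix s a" "mix s (mix a b) \<circ> q = mix s b" for s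
  proof -
    have "mix s (mix a b) (r i) = mix s a i \<and> mix s (mix a b) (q i) = mix s b i" for i
    proof -
      consider j where "i = 2 * j" | j where "i = Suc (2 * j)"
        by (metis evenE oddE add.commute plus_1_eq_Suc)
      then show ?thesis
        by cases (auto simp: r_def q_def mix_def)
    qed
    then show "mix s (mix a b) \<circ> r = mix s a" "mix s (mix a b) \<circ> q = mix s b"
      by (simp_all add: fun_eq_iff)
  qed
  ultimately show ?thesis
    using a b by (intro that[of "mix a b" "rename r \<phi>" "rename q \<psi>"])
      (auto simp: sat_rename mix_def)
qed

lemma definable_not: "definable C P \<Longrightarrow> definable C (\<lambda>s. \<not> P s)"
  unfolding definable_def by (metis sat.simps(4))

lemma definable_and: "definable C P \<Longrightarrow> definable C Q \<Longrightarrow> definable C (\<lambda>s. P s \<and> Q s)"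
  by (erule definable_merge, assumption) (unfold definable_def, metis sat.simps(5))

lemma definable_or: "definable C P \<Longrightarrow> definable C Q \<Longrightarrow> definable C (\<lambda>s. P s \<or> Q s)"
  by (rule definable_cong[where Q="\<lambda>s. \<not> (\<not> P s \<and> \<not> Q s)"]) (simp, intro definable_not definable_and)

lemma definable_imp: "definable C P \<Longrightarrow> definable C Q \<Longrightarrow> definable C (\<lambda>s. P s \<longrightarrow> Q s)"
  by (rule definable_cong[where Q="\<lambda>s. \<not> (P s \<and> \<not> Q s)"]) (simp, intro definable_not definable_and)

lemma definable_iff: "definable C P \<Longrightarrow> definable C Q \<Longrightarrow> definable C (\<lambda>s. P s \<longleftrightarrow> Q s)"
  by (rule definable_cong[where Q="\<lambda>s. (P s \<longrightarrow> Q s) \<and> (Q s \<longrightarrow> P s)"]) (blast, intro definable_imp definable_and)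

lemma var_or_par_Def2:
  assumes "var_or_par C t" "var_or_par C u"
  obtains i j e where "\<forall>i. e i \<in> params C" "t = (\<lambda>s. mix s e i)" "u = (\<lambda>s. mix s e j)"
proof -
  have 1: "At \<in> params C" by (simp add: params_def)
  consider i j where "t = (\<lambda>s. s i)" "u = (\<lambda>s. s j)"
    | i c where "t = (\<lambda>s. s i)" "c \<in> params C" "u = (\<lambda>s. c)"
    | i c where "u = (\<lambda>s. s i)" "c \<in> params C" "t = (\<lambda>s. c)"
    | c d where "c \<in> params C" "d \<in> params C" "t = (\<lambda>s. c)" "u = (\<lambda>s. d)"
    using assms unfolding var_or_par_def by blast
  then show ?thesis
  proof cases
    case 1 then show ?thesis
      using that[of "\<lambda>_. At" "2 * i" "2 * j"] \<open>At \<in> params C\<close> by simp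
  next
    case 2 then show ?thesis
      using that[of "\<lambda>_. c" "2 * i" "Suc (2 * 0)"] 2 by (simp only: mix_even mix_odd simp_thms)
  next
    case 3 then show ?thesis
      using that[of "\<lambda>_. c" "Suc (2 * 0)" "2 * i"] 3 by (simp only: mix_even mix_odd simp_thms)
  next
    case 4 then show ?thesis
      using that[of "(\<lambda>_. c)(1 := d)" "Suc (2 * 0)" "Suc (2 * 1)"] 4 by (simp only: mix_even mix_odd) simp
  qed
qed

lemma definable_el: "var_or_par C t \<Longrightarrow> var_or_par C u \<Longrightarrow> definable C (\<lambda>s. el M (t s) (u s))"
  by (erule var_or_par_Def2, assumption) (unfold definable_def, metis sat.simps(1))

lemma definable_eq: "var_or_par C t \<Longrightarrow> var_or_par C u \<Longrightarrow> definable C (\<lambda>s. t s = u s)"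
  by (erule var_or_par_Def2, assumption) (unfold definable_def, metis sat.simps(2))

text \<open>
  The bound variable becomes the variable 0 and the others are shifted. As a rule for backward
  reasoning this instantiates \<open>P\<close> by higher-order pattern matching, so that definability of a concrete
  formula is found by introduction rules alone.
\<close>

lemma definable_all:
  assumes "definable C (\<lambda>s. P (\<lambda>i. s (Suc i)) (s 0))"
  shows "definable C (\<lambda>s. \<forall>x\<in>U. P s x)"
proof -
  obtain \<phi> e where e: "\<forall>i. e i \<in> params C"
    "\<And>s. env s \<Longrightarrow> P (\<lambda>i. s (Suc i)) (s 0) = sat M \<phi> (mix s e)"
    using assms unfolding definable_def by blast
  \<comment> \<open>The bound variable takes over the first parameter position, and the parameters move up by one.\<close>
  define r :: "nat \<Rightarrow> nat" where "r i = (if i = 0 then 1 else if even i then i - 2 else i + 2)" for i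
  define d where "d = case_nat At e"
  have r: "inj r"
    unfolding inj_def r_def by (auto split: if_splits) presburger+
  have "(mix s d)(1 := x) \<circ> r = mix (case_nat x s) e" for s x
  proof
    fix i
    consider "i = 0" | j where "i = 2 * Suc j" | j where "i = Suc (2 * j)"
      by (metis evenE oddE add.commute not0_implies_Suc plus_1_eq_Suc mult_0_right)
    then show "((mix s d)(1 := x) \<circ> r) i = mix (case_nat x s) e i"
      by cases (auto simp: r_def d_def mix_def)
  qed
  moreover have "P s x = sat M \<phi> (mix (case_nat x s) e)" if "env s" "x \<in> U" for s x
    using e(2)[of "case_nat x s"] that by (simp add: env_def split: nat.split)
  ultimately have "(\<forall>x\<in>U. P s x) = sat M (FAll 1 (rename r \<phi>)) (mix s d)" if "env s" for s
    using that by (simp add: sat_rename[OF r] del: One_nat_def)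
  moreover have "\<forall>i. d i \<in> params C"
    using e(1) by (simp add: d_def params_def split: nat.split)
  ultimately show ?thesis unfolding definable_def by blast
qed

lemma definable_ex: "definable C (\<lambda>s. P (\<lambda>i. s (Suc i)) (s 0)) \<Longrightarrow> definable C (\<lambda>s. \<exists>x\<in>U. P s x)"
  by (rule definable_cong[where Q="\<lambda>s. \<not> (\<forall>x\<in>U. \<not> P s x)"]) (simp, intro definable_not definable_all)

lemma elts_iff: "z \<in> E x \<longleftrightarrow> z \<in> U \<and> el M z x"
  by (simp add: elts_def)

lemma elts_U: "z \<in> E x \<Longrightarrow> z \<in> U"
  by (simp add: elts_def)

lemma definable_elts: "var_or_par C t \<Longrightarrow> var_or_par C u \<Longrightarrow> definable C (\<lambda>s. t s \<in> E (u s))"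
  by (rule definable_cong[where Q="\<lambda>s. el M (t s) (u s)"]) (simp_all add: elts_iff var_or_par_U definable_el)

lemma definable_ball:
  assumes t: "var_or_par C t" and "definable C (\<lambda>s. P (\<lambda>i. s (Suc i)) (s 0))"
  shows "definable C (\<lambda>s. \<forall>x\<in>E (t s). P s x)"
proof (rule definable_cong)
  show "(\<forall>x\<in>E (t s). P s x) = (\<forall>x\<in>U. x \<in> E (t s) \<longrightarrow> P s x)" if "env s" for s
    using elts_U by blast
  show "definable C (\<lambda>s. \<forall>x\<in>U. x \<in> E (t s) \<longrightarrow> P s x)"
    by (intro definable_all definable_imp definable_elts assms var_or_par_var var_or_par_shift[OF t])
qed

lemma definable_bex: "var_or_par C t \<Longrightarrow> definable C (\<lambda>s. P (\<lambda>i. s (Suc i)) (s 0)) \<Longrightarrow> definable C (\<lambda>s. \<exists>x\<in>E (t s). P s x)"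
  by (rule definable_cong[where Q="\<lambda>s. \<not> (\<forall>x\<in>E (t s). \<not> P s x)"]) (simp, intro definable_not definable_ball)

lemmas definable_basic = definable_not definable_and definable_or definable_imp definable_iff definable_all definable_ex definable_ball definable_bex
  definable_elts definable_eq var_or_par_var var_or_par_At

lemma definable_is_set:
  assumes "var_or_par C t" shows "definable C (\<lambda>s. is_set M (t s))"
  by (rule definable_cong[where Q="\<lambda>s. \<not> t s \<in> E At"])
    (use assms in \<open>simp add: is_set_def var_or_par_U\<close>, intro definable_basic assms)

lemma definable_is_empty:
  assumes t: "var_or_par C t" shows "definable C (\<lambda>s. is_empty M (t s))"
proof (rule definable_cong)
  show "is_empty M (t s) \<longleftrightarrow> is_set M (t s) \<and> (\<forall>z\<in>E (t s). z \<noteq> z)" for s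
    by (auto simp: is_empty_def)
qed (intro definable_basic definable_is_set t)

lemma definable_is_succ:
  assumes t: "var_or_par C t" and u: "var_or_par C u" shows "definable C (\<lambda>s. is_succ M (t s) (u s))"
proof (rule definable_cong)
  show "is_succ M (t s) (u s) = (is_set M (u s) \<and> t s \<in> E (u s) \<and>
      (\<forall>z\<in>E (u s). z = t s \<or> z \<in> E (t s)) \<and> (\<forall>z\<in>E (t s). z \<in> E (u s)))" if "env s" for s
    using var_or_par_U[OF t that] by (auto simp: is_succ_def)
qed (intro definable_basic definable_is_set t u var_or_par_shift[OF t] var_or_par_shift[OF u])

lemma definable_is_upair:
  assumes t: "var_or_par C t" and u: "var_or_par C u" and v: "var_or_par C v"
  shows "definable C (\<lambda>s. is_upair M (t s) (u s) (v s))"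
proof (rule definable_cong)
  show "is_upair M (t s) (u s) (v s) = (is_set M (v s) \<and> t s \<in> E (v s) \<and> u s \<in> E (v s) \<and>
      (\<forall>z\<in>E (v s). z = t s \<or> z = u s))" if "env s" for s
    by (auto simp: is_upair_def)
qed (intro definable_basic definable_is_set t u v var_or_par_shift[OF t] var_or_par_shift[OF u])

lemma definable_is_pair:
  assumes t: "var_or_par C t" and u: "var_or_par C u" and v: "var_or_par C v"
  shows "definable C (\<lambda>s. is_pair M (t s) (u s) (v s))"
  unfolding is_pair_def
  by (intro definable_basic definable_is_upair t[THEN var_or_par_shift, THEN var_or_par_shift]
      u[THEN var_or_par_shift, THEN var_or_par_shift] v[THEN var_or_par_shift, THEN var_or_par_shift])

lemma definable_app:
  assumes t: "var_or_par C t" and u: "var_or_par C u" and v: "var_or_par C v"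
  shows "definable C (\<lambda>s. app M (t s) (u s) (v s))"
  unfolding app_def
  by (intro definable_basic definable_is_pair t u[THEN var_or_par_shift] v[THEN var_or_par_shift])

lemma app_U: "app M f u v \<Longrightarrow> u \<in> U \<and> v \<in> U"
  unfolding app_def is_pair_def is_upair_def elts_def by blast

lemma definable_is_fun:
  assumes t: "var_or_par C t" and u: "var_or_par C u" and v: "var_or_par C v"
  shows "definable C (\<lambda>s. is_fun M (t s) (u s) (v s))"
proof -
  have [simp]: "(\<exists>!w. app M f x w) \<longleftrightarrow> (\<exists>w\<in>U. app M f x w \<and> (\<forall>w'\<in>U. app M f x w' \<longrightarrow> w' = w))" for f x
    unfolding Ex1_def using app_U by blast
  show ?thesis unfolding is_fun_def
    apply simp
    by (intro definable_basic definable_is_set definable_app definable_is_pair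
        t t[THEN var_or_par_shift] t[THEN var_or_par_shift, THEN var_or_par_shift]
        t[THEN var_or_par_shift, THEN var_or_par_shift, THEN var_or_par_shift] u u[THEN var_or_par_shift] v[THEN var_or_par_shift, THEN var_or_par_shift])
qed

lemma definable_is_inj:
  assumes t: "var_or_par C t" and u: "var_or_par C u" and v: "var_or_par C v"
  shows "definable C (\<lambda>s. is_inj M (t s) (u s) (v s))"
proof (rule definable_cong)
  show "is_inj M (t s) (u s) (v s) \<longleftrightarrow> is_fun M (t s) (u s) (v s) \<and>
    (\<forall>x\<in>U. \<forall>x'\<in>U. \<forall>y\<in>U. app M (t s) x y \<and> app M (t s) x' y \<longrightarrow> x = x')" for s
    unfolding is_inj_def using app_U by meson
qed (intro definable_basic definable_is_fun definable_app t u v t[THEN var_or_par_shift, THEN var_or_par_shift, THEN var_or_par_shift])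

lemma definable_is_bij:
  assumes t: "var_or_par C t" and u: "var_or_par C u" and v: "var_or_par C v"
  shows "definable C (\<lambda>s. is_bij M (t s) (u s) (v s))"
proof (rule definable_cong)
  show "is_bij M (t s) (u s) (v s) \<longleftrightarrow> is_inj M (t s) (u s) (v s) \<and>
    (\<forall>y\<in>E (v s). \<exists>x\<in>U. app M (t s) x y)" for s
    unfolding is_bij_def using app_U by meson
qed (intro definable_basic definable_is_inj definable_app t u v t[THEN var_or_par_shift, THEN var_or_par_shift])

lemma definable_is_inductive:
  assumes t: "var_or_par C t" shows "definable C (\<lambda>s. is_inductive M (t s))"
  unfolding is_inductive_def
  by (intro definable_basic definable_is_set definable_is_empty definable_is_succ t t[THEN var_or_par_shift])

lemma definable_is_transitive:
  assumes t: "var_or_par C t" shows "definable C (\<lambda>s. is_transitive M (t s))"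
  unfolding is_transitive_def subset_iff Ball_def[symmetric]
  by (intro definable_basic definable_is_set t t[THEN var_or_par_shift] t[THEN var_or_par_shift, THEN var_or_par_shift])

lemma definable_subset:
  assumes t: "var_or_par C t" and u: "var_or_par C u" shows "definable C (\<lambda>s. E (t s) \<subseteq> E (u s))"
  unfolding subset_iff Ball_def[symmetric]
  by (intro definable_basic t u[THEN var_or_par_shift])

lemma definable_tc_elts:
  assumes t: "var_or_par C t" and u: "var_or_par C u"
  shows "definable C (\<lambda>s. t s \<in> tc_elts M (u s))"
proof (rule definable_cong)
  show "(t s \<in> tc_elts M (u s)) = (\<forall>x\<in>U. is_transitive M x \<and> u s \<in> E x \<longrightarrow> t s \<in> E x)" if "env s" for s
    using var_or_par_U[OF t that] unfolding tc_elts_def is_transitive_def is_set_def by blast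
qed (intro definable_basic definable_is_transitive t[THEN var_or_par_shift] u[THEN var_or_par_shift])

lemmas definable_intros = definable_basic definable_is_set definable_is_empty definable_is_succ definable_is_upair definable_is_pair definable_app
  definable_is_fun definable_is_inj definable_is_bij definable_is_inductive definable_is_transitive definable_subset definable_tc_elts


section \<open>Set formation inside the structure\<close>

lemmas
  atoms_ax = ZFA[unfolded ZFA_AC_def, THEN conjunct2, THEN conjunct1] and
  ext_ax = ZFA[unfolded ZFA_AC_def, THEN conjunct2, THEN conjunct2, THEN conjunct1] and
  pair_ax = ZFA[unfolded ZFA_AC_def, THEN conjunct2, THEN conjunct2, THEN conjunct2, THEN conjunct1] and
  union_ax = ZFA[unfolded ZFA_AC_def, THEN conjunct2, THEN conjunct2, THEN conjunct2, THEN conjunct2, THEN conjunct1] and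
  power_ax = ZFA[unfolded ZFA_AC_def, THEN conjunct2, THEN conjunct2, THEN conjunct2, THEN conjunct2, THEN conjunct2, THEN conjunct1] and
  inf_ax = ZFA[unfolded ZFA_AC_def, THEN conjunct2, THEN conjunct2, THEN conjunct2, THEN conjunct2, THEN conjunct2, THEN conjunct2, THEN conjunct1] and
  sep_ax = ZFA[unfolded ZFA_AC_def, THEN conjunct2, THEN conjunct2, THEN conjunct2, THEN conjunct2, THEN conjunct2, THEN conjunct2, THEN conjunct2, THEN conjunct1] and
  repl_ax = ZFA[unfolded ZFA_AC_def, THEN conjunct2, THEN conjunct2, THEN conjunct2, THEN conjunct2, THEN conjunct2, THEN conjunct2, THEN conjunct2, THEN conjunct2, THEN conjunct1] and
  found_ax = ZFA[unfolded ZFA_AC_def, THEN conjunct2, THEN conjunct2, THEN conjunct2, THEN conjunct2, THEN conjunct2, THEN conjunct2, THEN conjunct2, THEN conjunct2, THEN conjunct2, THEN conjunct1]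

text \<open>
  The axiom schemas use the variables 0 and 1, whereas \<open>mix\<close> places two free variables at 0 and 2.
\<close>

lemma definable2_formula:
  assumes "definable UNIV (\<lambda>s. R (s 0) (s (Suc 0)))"
  shows "\<exists>\<phi> b. (\<forall>i. b i \<in> U) \<and> (\<forall>u\<in>U. \<forall>v\<in>U. R u v \<longleftrightarrow> sat M \<phi> (b(0 := u, 1 := v)))"
proof -
  obtain \<phi> e where e: "\<forall>i. e i \<in> params UNIV"
    "\<And>s. env s \<Longrightarrow> R (s 0) (s (Suc 0)) = sat M \<phi> (mix s e)"
    using assms unfolding definable_def by blast
  define r :: "nat \<Rightarrow> nat" where "r i = (if i = 1 then 2 else if i = 2 then 1 else i)" for i
  define b where "b = mix (\<lambda>_. At) e \<circ> r"
  have r: "inj r" by (auto simp: inj_def r_def split: if_splits)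
  have "b(0 := u, 1 := v) \<circ> r = mix ((\<lambda>_. At)(0 := u, 1 := v)) e" for u v
  proof
    fix i :: nat
    consider "i = 0" | "i = 1" | "i = 2" | "i > 2" by linarith
    moreover have "even i \<Longrightarrow> i > 2 \<Longrightarrow> i div 2 \<noteq> 0 \<and> i div 2 \<noteq> 1" by presburger
    ultimately show "(b(0 := u, 1 := v) \<circ> r) i = mix ((\<lambda>_. At)(0 := u, 1 := v)) e i"
      by cases (auto simp: b_def r_def mix_def)
  qed
  then have "R u v \<longleftrightarrow> sat M (rename r \<phi>) (b(0 := u, 1 := v))" if "u \<in> U" "v \<in> U" for u v
    using e(2)[of "(\<lambda>_. At)(0 := u, 1 := v)"] that by (simp add: sat_rename[OF r] env_def)
  moreover have "\<forall>i. b i \<in> U"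
    using e(1) params_U by (auto simp: b_def mix_def)
  ultimately show ?thesis by blast
qed

text \<open>
  A class of objects is small if it is the extension of a set of the structure, which \<open>as_set\<close> then
  returns.
\<close>

definition small :: "'u set \<Rightarrow> bool" where
  "small S \<longleftrightarrow> (\<exists>y. is_set M y \<and> E y = S)"

definition as_set :: "'u set \<Rightarrow> 'u" where
  "as_set S = (THE y. is_set M y \<and> E y = S)"

lemma extensionality: "is_set M x \<Longrightarrow> is_set M y \<Longrightarrow> E x = E y \<Longrightarrow> x = y"
  using ext_ax by blast

lemma set_U: "is_set M x \<Longrightarrow> x \<in> U"
  by (simp add: is_set_def)

lemma as_set_eq: "is_set M y \<Longrightarrow> E y = S \<Longrightarrow> as_set S = y"
  unfolding as_set_def by (rule the_equality) (auto intro: extensionality)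

lemma
  assumes "small S"
  shows is_set_as_set [simp]: "is_set M (as_set S)" and elts_as_set [simp]: "E (as_set S) = S" and as_set_U [simp]: "as_set S \<in> U"
proof -
  obtain y where "is_set M y" "E y = S" using assms unfolding small_def by blast
  then show "is_set M (as_set S)" "E (as_set S) = S" "as_set S \<in> U" using as_set_eq[of y S] set_U by simp_all
qed

lemma smallE:
  assumes "small S" obtains y where "is_set M y" "y \<in> U" "E y = S"
  using that[of "as_set S"] assms by simp

lemma as_set_inj: "small S \<Longrightarrow> small T \<Longrightarrow> as_set S = as_set T \<longleftrightarrow> S = T"
  by (metis elts_as_set)

lemma small_upair [simp]: "a \<in> U \<Longrightarrow> b \<in> U \<Longrightarrow> small {a, b}"
  using pair_ax unfolding is_upair_def small_def by blast

lemma small_sing [simp]: "a \<in> U \<Longrightarrow> small {a}"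
  using small_upair[of a a] by simp

lemma small_Union: "x \<in> U \<Longrightarrow> small (\<Union>y\<in>E x. E y)"
  using union_ax unfolding small_def by blast

lemma small_Pow: "x \<in> U \<Longrightarrow> small {y. is_set M y \<and> E y \<subseteq> E x}"
  using power_ax unfolding small_def by blast

lemma small_Un [simp]: "x \<in> U \<Longrightarrow> y \<in> U \<Longrightarrow> small (E x \<union> E y)"
  using small_Union[of "as_set {x, y}"] by simp

lemma small_insert [simp]: "x \<in> U \<Longrightarrow> a \<in> U \<Longrightarrow> small (insert a (E x))"
  using small_Un[of "as_set {a}" x] by simp

lemma small_sep:
  assumes "definable UNIV (\<lambda>s. P (s 0))" "x \<in> U"
  shows "small {z \<in> E x. P z}"
proof -
  obtain \<phi> b where b: "\<forall>i. b i \<in> U"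
    "\<And>u v. u \<in> U \<Longrightarrow> v \<in> U \<Longrightarrow> P u \<longleftrightarrow> sat M \<phi> (b(0 := u, 1 := v))"
    using definable2_formula[of "\<lambda>u v. P u", OF assms(1)] by blast
  have "\<forall>i. (b(1 := At)) i \<in> U" using b by simp
  then obtain y where y: "is_set M y" "E y = {z \<in> E x. sat M \<phi> ((b(1 := At))(0 := z))}"
    using sep_ax[rule_format, OF _ assms(2), of "b(1 := At)" \<phi>] by auto
  moreover have "sat M \<phi> ((b(1 := At))(0 := z)) \<longleftrightarrow> P z" if "z \<in> U" for z
    using b(2)[OF that, of At] by (simp add: fun_upd_twist)
  ultimately have "E y = {z \<in> E x. P z}" using elts_U by auto
  then show ?thesis unfolding small_def using y(1) by blast
qed

lemma small_repl:
  assumes "definable UNIV (\<lambda>s. R (s 0) (s (Suc 0)))" "x \<in> U"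
    and "\<And>u v v'. u \<in> E x \<Longrightarrow> v \<in> U \<Longrightarrow> v' \<in> U \<Longrightarrow> R u v \<Longrightarrow> R u v' \<Longrightarrow> v = v'"
  shows "small {v \<in> U. \<exists>u\<in>E x. R u v}"
proof -
  obtain \<phi> b where b: "\<forall>i. b i \<in> U"
    "\<And>u v. u \<in> U \<Longrightarrow> v \<in> U \<Longrightarrow> R u v \<longleftrightarrow> sat M \<phi> (b(0 := u, 1 := v))"
    using definable2_formula[of R, OF assms(1)] by blast
  have "(\<forall>u\<in>E x. \<forall>v\<in>U. \<forall>v'\<in>U. sat M \<phi> (b(0 := u, 1 := v)) \<and> sat M \<phi> (b(0 := u, 1 := v')) \<longrightarrow> v = v')"
    using b(2) assms(3) elts_U by blast
  then obtain y where "is_set M y" "E y = {v \<in> U. \<exists>u\<in>E x. sat M \<phi> (b(0 := u, 1 := v))}"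
    using repl_ax[THEN spec[of _ \<phi>], THEN spec[of _ b]] b(1) assms(2) by blast
  moreover have "{v \<in> U. \<exists>u\<in>E x. sat M \<phi> (b(0 := u, 1 := v))} = {v \<in> U. \<exists>u\<in>E x. R u v}"
    using b(2) elts_U by blast
  ultimately show ?thesis unfolding small_def by blast
qed

lemma foundation: "x \<in> U \<Longrightarrow> y \<in> E x \<Longrightarrow> \<exists>z\<in>E x. E z \<inter> E x = {}"
  using found_ax by blast

lemma elts_atom: "a \<in> E At \<Longrightarrow> E a = {}"
  using atoms_ax by blast

lemma not_self: "x \<notin> E x"
proof
  assume "x \<in> E x"
  then have "x \<in> U" by (rule elts_U)
  then show False using foundation[of "as_set {x}" x] \<open>x \<in> E x\<close> by auto
qed

lemma is_set_At [simp]: "is_set M At"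
  using not_self by (simp add: is_set_def)

subsection \<open>Ordered pairs and relations\<close>

definition opair :: "'u \<Rightarrow> 'u \<Rightarrow> 'u" where
  "opair a b = as_set {as_set {a}, as_set {a, b}}"

lemma opair_U [simp]: "a \<in> U \<Longrightarrow> b \<in> U \<Longrightarrow> opair a b \<in> U"
  by (simp add: opair_def)

lemma is_upair_iff: "is_upair M a b c \<longleftrightarrow> a \<in> U \<and> b \<in> U \<and> c = as_set {a, b}"
  unfolding is_upair_def using elts_U[of _ c] by (auto simp: as_set_eq)

lemma is_pair_iff: "is_pair M a b p \<longleftrightarrow> a \<in> U \<and> b \<in> U \<and> p = opair a b"
  unfolding is_pair_def is_upair_iff opair_def by auto

lemma opair_inject [simp]:
  assumes "a \<in> U" "b \<in> U" "c \<in> U" "d \<in> U"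
  shows "opair a b = opair c d \<longleftrightarrow> a = c \<and> b = d"
  unfolding opair_def using assms
  by (auto simp: as_set_inj doubleton_eq_iff)

lemma app_iff: "app M f x y \<longleftrightarrow> x \<in> U \<and> y \<in> U \<and> opair x y \<in> E f"
  unfolding app_def is_pair_iff by auto

text \<open>
  The relation is separated from a double power set of \<open>X \<union> Y\<close>, since \<open>(u, v) = {{u}, {u, v}}\<close>.
\<close>

lemma small_rel:
  assumes "definable UNIV (\<lambda>s. R (s (Suc 0)) (s 0))" "X \<in> U" "Y \<in> U"
  shows "small {opair u v |u v. u \<in> E X \<and> v \<in> E Y \<and> R u v}" (is "small ?S")
proof -
  obtain W where W: "is_set M W" "W \<in> U" "E W = E X \<union> E Y"
    using small_Un[OF assms(2,3)] by (rule smallE)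
  obtain P where P: "is_set M P" "P \<in> U" "E P = {y. is_set M y \<and> E y \<subseteq> E W}"
    using small_Pow[OF W(2)] by (rule smallE)
  obtain Q where Q: "is_set M Q" "Q \<in> U" "E Q = {y. is_set M y \<and> E y \<subseteq> E P}"
    using small_Pow[OF P(2)] by (rule smallE)
  have "opair u v \<in> E Q" if "u \<in> E X" "v \<in> E Y" for u v
  proof -
    have "u \<in> U" "v \<in> U" using that elts_U by auto
    then have "as_set {u} \<in> E P" "as_set {u, v} \<in> E P" using that by (auto simp: P W)
    then show ?thesis using \<open>u \<in> U\<close> \<open>v \<in> U\<close> by (simp add: Q opair_def)
  qed
  then have "?S = {z \<in> E Q. \<exists>u\<in>E X. \<exists>v\<in>E Y. is_pair M u v z \<and> R u v}"
    using elts_U by (auto simp: is_pair_iff)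
  also have "small \<dots>"
    by (rule small_sep) (intro definable_intros var_or_par_const assms UNIV_I Q(2))+
  finally show ?thesis .
qed

definition rel :: "'u \<Rightarrow> 'u \<Rightarrow> ('u \<Rightarrow> 'u \<Rightarrow> bool) \<Rightarrow> 'u" where
  "rel X Y R = as_set {opair u v |u v. u \<in> E X \<and> v \<in> E Y \<and> R u v}"

lemma
  assumes "definable UNIV (\<lambda>s. R (s (Suc 0)) (s 0))" "X \<in> U" "Y \<in> U"
  shows is_set_rel: "is_set M (rel X Y R)"
    and elts_rel: "E (rel X Y R) = {opair u v |u v. u \<in> E X \<and> v \<in> E Y \<and> R u v}"
    and app_rel: "app M (rel X Y R) u v \<longleftrightarrow> u \<in> E X \<and> v \<in> E Y \<and> R u v"
  using small_rel[OF assms] elts_U unfolding rel_def by (auto simp: app_iff)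

lemma app_insert:
  assumes "x \<in> U" "y \<in> U" "g \<in> U"
  shows "app M (as_set (insert (opair x y) (E g))) u v \<longleftrightarrow> app M g u v \<or> u = x \<and> v = y"
  using assms by (auto simp: app_iff)

text \<open>
  The field of a relation lies in the double union of the relation.
\<close>

lemma app_bound:
  assumes "g \<in> U"
  shows "\<exists>W\<in>U. \<forall>u v. app M g u v \<longrightarrow> u \<in> E W \<and> v \<in> E W"
proof -
  obtain HS where HS: "is_set M HS" "HS \<in> U" "E HS = (\<Union>y\<in>E g. E y)"
    using small_Union[OF assms] by (rule smallE)
  obtain W where W: "is_set M W" "W \<in> U" "E W = (\<Union>y\<in>E HS. E y)"
    using small_Union[OF HS(2)] by (rule smallE)
  have "u \<in> E W \<and> v \<in> E W" if "app M g u v" for u v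
  proof -
    have "u \<in> U" "v \<in> U" "opair u v \<in> E g" using that by (auto simp: app_iff)
    moreover from this have "as_set {u, v} \<in> E (opair u v)" "E (as_set {u, v}) = {u, v}" by (auto simp: opair_def)
    ultimately show ?thesis unfolding W(3) HS(3) by blast
  qed
  with W(2) show ?thesis by blast
qed

subsection \<open>The natural numbers of the structure\<close>

definition zero :: 'u where "zero = as_set {}"

definition suc :: "'u \<Rightarrow> 'u" where "suc n = as_set (insert n (E n))"

definition omega :: 'u where "omega = (THE w. is_omega M w)"

lemma small_empty: "small {}"
proof -
  have "small {z \<in> E At. z \<noteq> z}"
    by (rule small_sep) (intro definable_intros At_U)+
  then show ?thesis by simp
qed

lemma zero_simps [simp]: "is_set M zero" "E zero = {}" "zero \<in> U"
  using small_empty by (simp_all add: zero_def)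

lemma suc_simps [simp]: "n \<in> U \<Longrightarrow> is_set M (suc n)" "n \<in> U \<Longrightarrow> E (suc n) = insert n (E n)" "n \<in> U \<Longrightarrow> suc n \<in> U"
  by (simp_all add: suc_def)

lemma is_empty_iff: "is_empty M e \<longleftrightarrow> e = zero"
  unfolding is_empty_def by (auto intro: extensionality)

lemma is_succ_iff: "n \<in> U \<Longrightarrow> is_succ M n k \<longleftrightarrow> k = suc n"
  unfolding is_succ_def by (auto intro: extensionality)

lemma is_inductive_iff:
  "is_inductive M w \<longleftrightarrow> is_set M w \<and> zero \<in> E w \<and> (\<forall>n\<in>E w. suc n \<in> E w)"
  unfolding is_inductive_def using elts_U by (auto simp: is_empty_iff is_succ_iff)

lemma is_omega_unique:
  assumes "is_omega M v" "is_omega M w" shows "v = w"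
proof (rule extensionality)
  show "is_set M v" "is_set M w" using assms by (simp_all add: is_omega_def is_inductive_def)
  show "E v = E w" using assms by (simp add: is_omega_def subset_antisym)
qed

lemma is_omega_omega: "is_omega M omega"
proof -
  obtain w0 where w0: "is_inductive M w0"
    using inf_ax by blast
  let ?S = "{n \<in> E w0. \<forall>v\<in>U. is_inductive M v \<longrightarrow> n \<in> E v}"
  have "small ?S"
  proof (rule small_sep)
    show "definable UNIV (\<lambda>s. \<forall>v\<in>U. is_inductive M v \<longrightarrow> s 0 \<in> E v)" by (intro definable_intros)
    show "w0 \<in> U" using w0 by (simp add: is_inductive_def set_U)
  qed
  then have "is_omega M (as_set ?S)" (is "is_omega M ?w")
    unfolding is_omega_def is_inductive_iff using w0 by (auto simp: is_inductive_iff set_U)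
  then show ?thesis unfolding omega_def by (rule theI) (rule is_omega_unique[OF _ \<open>is_omega M ?w\<close>])
qed

lemma is_omega_iff: "is_omega M w \<longleftrightarrow> w = omega"
  using is_omega_omega is_omega_unique by blast

lemma is_nat_iff: "is_nat M n \<longleftrightarrow> n \<in> E omega"
  unfolding is_nat_def is_omega_iff by blast

lemma omega_simps [simp]: "is_set M omega" "omega \<in> U" "zero \<in> E omega" "n \<in> E omega \<Longrightarrow> suc n \<in> E omega"
  using is_omega_omega by (auto simp: is_omega_def is_inductive_iff set_U)

lemma omega_U [simp]: "n \<in> E omega \<Longrightarrow> n \<in> U"
  by (rule elts_U)

text \<open>
  Only definable predicates qualify, because the natural numbers of the structure may be
  nonstandard.
\<close>

lemma omega_induct [consumes 1, case_names definable zero suc]: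
  assumes "n \<in> E omega" "definable UNIV (\<lambda>s. P (s 0))" "P zero"
    "\<And>n. n \<in> E omega \<Longrightarrow> P n \<Longrightarrow> P (suc n)"
  shows "P n"
proof -
  have sm: "small {n \<in> E omega. P n}" by (rule small_sep) (simp_all add: assms)
  then have "is_inductive M (as_set {n \<in> E omega. P n})"
    unfolding is_inductive_iff using assms by auto
  then have "E omega \<subseteq> E (as_set {n \<in> E omega. P n})"
    using is_omega_omega unfolding is_omega_def by blast
  then show ?thesis using sm assms(1) by auto
qed

lemma omega_trans: "n \<in> E omega \<Longrightarrow> E n \<subseteq> E omega"
proof (induction n rule: omega_induct)
  case definable show ?case by (intro definable_intros var_or_par_const) simp_all
qed auto

lemma nat_trans: "n \<in> E omega \<Longrightarrow> \<forall>m\<in>E n. E m \<subseteq> E n"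
proof (induction n rule: omega_induct)
  case definable show ?case by (intro definable_intros)
qed auto

lemma nat_cases: "n \<in> E omega \<Longrightarrow> n = zero \<or> (\<exists>m\<in>E omega. n = suc m)"
proof -
  assume n: "n \<in> E omega"
  have "n = zero \<or> (\<exists>m\<in>E omega. is_succ M m n)"
    using n
  proof (induction n rule: omega_induct)
    case definable show ?case unfolding is_empty_iff[symmetric] by (intro definable_intros var_or_par_const) simp_all
  qed (auto simp: is_succ_iff)
  then show ?thesis by (auto simp: is_succ_iff)
qed

lemma suc_inject: "m \<in> E omega \<Longrightarrow> n \<in> E omega \<Longrightarrow> suc m = suc n \<Longrightarrow> m = n"
  using nat_trans[of m] nat_trans[of n] not_self[of m] suc_simps(2)[of m] suc_simps(2)[of n] omega_U
  by (metis insertE insertI1 subsetD)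

lemma suc_neq_zero: "m \<in> U \<Longrightarrow> suc m \<noteq> zero"
  using suc_simps(2)[of m] zero_simps(2) by force

lemma zero_in_suc: "n \<in> E omega \<Longrightarrow> zero \<in> E (suc n)"
proof -
  assume n: "n \<in> E omega"
  have "n = zero \<or> zero \<in> E n"
    using n
  proof (induction n rule: omega_induct)
    case definable show ?case unfolding is_empty_iff[symmetric] by (intro definable_intros var_or_par_const) simp_all
  qed auto
  then show ?thesis using n by auto
qed

lemma suc_mono: "n \<in> E omega \<Longrightarrow> m \<in> E n \<Longrightarrow> suc m \<in> E (suc n)"
proof -
  assume n: "n \<in> E omega" and m: "m \<in> E n"
  have "\<forall>m\<in>E n. \<exists>k\<in>U. is_succ M m k \<and> (k = n \<or> k \<in> E n)"
    using n
  proof (induction n rule: omega_induct)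
    case definable show ?case by (intro definable_intros)
  next
    case (suc n)
    have "m \<in> U" "is_succ M m k \<longleftrightarrow> k = suc m" if "m \<in> E n" for m k
      using that elts_U is_succ_iff by auto
    then show ?case using suc by (auto simp: is_succ_iff)
  qed simp
  then show ?thesis using n m elts_U[OF m] by (auto simp: is_succ_iff)
qed

text \<open>
  A common strict upper bound of two natural numbers is what combines the bounds found for two parts
  of a finite set.
\<close>

lemma nat_directed: "j \<in> E omega \<Longrightarrow> k \<in> E omega \<Longrightarrow> \<exists>m\<in>E omega. j \<in> E m \<and> k \<in> E m"
proof -
  assume j: "j \<in> E omega"
  show "\<exists>m\<in>E omega. j \<in> E m \<and> k \<in> E m" if "k \<in> E omega"
    using that
  proof (induction k rule: omega_induct)
    case definable show ?case by (intro definable_intros var_or_par_const) (simp_all add: j)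
  next
    case zero
    show ?case using zero_in_suc[OF j] j by (intro bexI[of _ "suc j"]) auto
  next
    case (suc k)
    then obtain m where "m \<in> E omega" "j \<in> E m" "k \<in> E m" by blast
    then show ?case using suc_mono by (intro bexI[of _ "suc m"]) auto
  qed
qed

section \<open>Transitive closures and induction over membership\<close>

definition is_Un :: "'u \<Rightarrow> 'u \<Rightarrow> bool" where
  "is_Un z y \<longleftrightarrow> is_set M y \<and> (\<forall>w\<in>U. w \<in> E y \<longleftrightarrow> (\<exists>v\<in>E z. w \<in> E v))"

lemma definable_is_Un:
  assumes t: "var_or_par C t" and u: "var_or_par C u" shows "definable C (\<lambda>s. is_Un (t s) (u s))"
  unfolding is_Un_def by (intro definable_intros t[THEN var_or_par_shift] u[THEN var_or_par_shift] u)

lemma is_Un_iff: "z \<in> U \<Longrightarrow> is_Un z y \<longleftrightarrow> y = as_set (\<Union>v\<in>E z. E v)"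
proof -
  assume z: "z \<in> U"
  have "is_Un z y \<longleftrightarrow> is_set M y \<and> E y = (\<Union>v\<in>E z. E v)"
    unfolding is_Un_def using elts_U by blast
  then show ?thesis using small_Union[OF z] as_set_eq[of y] by auto
qed

text \<open>
  Every pair in \<open>g\<close> is either \<open>(0, x)\<close> or obtained from another pair \<open>(m, z)\<close> of \<open>g\<close> as
  \<open>(m + 1, \<Union>z)\<close>. Such a \<open>g\<close> is a derivation that the \<open>m\<close>-fold union of \<open>x\<close> is \<open>z\<close> for each of its
  pairs. Compared with functions on initial segments, derivations can be extended by a single pair
  without any care for domains.
\<close>

definition unions :: "'u \<Rightarrow> 'u \<Rightarrow> bool" where
  "unions x g \<longleftrightarrow> (\<forall>m\<in>U. \<forall>z\<in>U. app M g m z \<longrightarrow> is_empty M m \<and> z = x \<or>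
    (\<exists>m'\<in>E omega. \<exists>z'\<in>U. is_succ M m' m \<and> is_Un z' z \<and> app M g m' z'))"

definition iter_Un :: "'u \<Rightarrow> 'u \<Rightarrow> 'u \<Rightarrow> bool" where
  "iter_Un x n y \<longleftrightarrow> (\<exists>g\<in>U. unions x g \<and> app M g n y)"

lemma definable_iter_Un:
  assumes "x \<in> U" and t: "var_or_par UNIV t" and u: "var_or_par UNIV u"
  shows "definable UNIV (\<lambda>s. iter_Un x (t s) (u s))"
  unfolding iter_Un_def unions_def
  by (intro definable_intros definable_is_Un t[THEN var_or_par_shift] u[THEN var_or_par_shift] var_or_par_const) (use assms in simp_all)

lemma iter_Un_zero: "x \<in> U \<Longrightarrow> iter_Un x zero x"
  unfolding iter_Un_def unions_def
  by (intro bexI[of _ "as_set {opair zero x}"]) (auto simp: app_iff is_empty_iff)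

lemma iter_Un_suc:
  assumes "x \<in> U" "n \<in> E omega" "iter_Un x n y"
  shows "iter_Un x (suc n) (as_set (\<Union>v\<in>E y. E v))"
proof -
  obtain g where g: "g \<in> U" "unions x g" "app M g n y"
    using assms(3) unfolding iter_Un_def by blast
  let ?y = "as_set (\<Union>v\<in>E y. E v)"
  let ?g = "as_set (insert (opair (suc n) ?y) (E g))"
  have y: "y \<in> U" using g app_U by blast
  then have y': "?y \<in> U" "is_Un y ?y" using small_Union by (auto simp: is_Un_iff)
  have n: "n \<in> U" using assms by simp
  note a = app_insert[OF suc_simps(3)[OF n] y'(1) g(1)]
  have "unions x ?g"
    using g assms(2) y y' unfolding unions_def a by (metis is_succ_iff n)
  moreover have "?g \<in> U" using y' n g by simp
  ultimately show ?thesis unfolding iter_Un_def using a by blast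
qed

lemma iter_Un_unique:
  assumes "x \<in> U" "n \<in> E omega"
  shows "\<forall>y\<in>U. \<forall>y'\<in>U. iter_Un x n y \<longrightarrow> iter_Un x n y' \<longrightarrow> y = y'"
  using assms(2)
proof (induction n rule: omega_induct)
  case definable show ?case by (intro definable_intros definable_iter_Un assms)
next
  case zero
  have "y = x" if "iter_Un x zero y" for y
    using that app_U suc_neq_zero unfolding iter_Un_def unions_def by (metis is_succ_iff omega_U)
  then show ?case by blast
next
  case (suc n)
  have *: "\<exists>z\<in>U. iter_Un x n z \<and> y = as_set (\<Union>v\<in>E z. E v)" if y: "iter_Un x (suc n) y" for y
  proof -
    obtain g where g: "g \<in> U" "unions x g" "app M g (suc n) y"
      using y unfolding iter_Un_def by blast
    then obtain m z where m: "m \<in> E omega" "z \<in> U" "is_succ M m (suc n)" "is_Un z y" "app M g m z"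
      unfolding unions_def using app_U suc_neq_zero is_empty_iff suc(1) omega_U by metis
    then have "m = n" using suc_inject suc(1) by (auto simp: is_succ_iff)
    then show ?thesis using m g unfolding iter_Un_def by (auto simp: is_Un_iff)
  qed
  show ?case using *[THEN bexE] suc(2) by metis
qed

text \<open>
  The union of all iterated unions of \<open>{x}\<close> is transitive. It is a set by replacement, because the
  \<open>n\<close>-fold union is unique.
\<close>

lemma transitive_superset:
  assumes "x \<in> U"
  obtains t where "is_transitive M t" "x \<in> E t"
proof -
  let ?x = "as_set {x}"
  have x: "?x \<in> U" using assms by simp
  let ?S = "{v \<in> U. \<exists>n\<in>E omega. iter_Un ?x n v}"
  have "small ?S"
  proof (rule small_repl)
    show "definable UNIV (\<lambda>s. iter_Un ?x (s 0) (s (Suc 0)))"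
      by (intro definable_iter_Un definable_intros x)
  qed (use iter_Un_unique[OF x] in auto)
  then have S: "as_set ?S \<in> U" "E (as_set ?S) = ?S" by simp_all
  then have sm: "small (\<Union>y\<in>?S. E y)" using small_Union[OF S(1)] by simp
  obtain t where "is_set M t" and t: "E t = (\<Union>y\<in>?S. E y)"
    using sm unfolding small_def by blast
  have t_iff: "z \<in> E t \<longleftrightarrow> (\<exists>n\<in>E omega. \<exists>y\<in>U. iter_Un ?x n y \<and> z \<in> E y)" for z
    unfolding t by blast
  have "E z \<subseteq> E t" if z: "z \<in> E t" for z
  proof
    fix w assume w: "w \<in> E z"
    obtain n y where y: "n \<in> E omega" "y \<in> U" "iter_Un ?x n y" "z \<in> E y"
      using z t_iff by blast
    let ?y = "as_set (\<Union>v\<in>E y. E v)"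
    have "w \<in> (\<Union>v\<in>E y. E v)" using y(4) w by blast
    then have "?y \<in> U" "w \<in> E ?y" using small_Union[OF y(2)] by simp_all
    moreover have "suc n \<in> E omega" using y(1) by simp
    moreover have "iter_Un ?x (suc n) ?y" using iter_Un_suc[OF x y(1,3)] .
    ultimately show "w \<in> E t" using t_iff by blast
  qed
  then have "is_transitive M t"
    unfolding is_transitive_def using \<open>is_set M t\<close> by blast
  moreover have "x \<in> E t"
    using iter_Un_zero[OF x] x assms unfolding t_iff by (intro bexI[of _ zero] bexI[of _ ?x]) simp_all
  ultimately show ?thesis using that by blast
qed

text \<open>
  The axiom of foundation speaks of sets. A counterexample \<open>x\<close> lies in a transitive set \<open>t\<close>, and
  foundation applies to the set of counterexamples in \<open>t\<close>.
\<close>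

lemma eps_induct [consumes 1, case_names definable step]:
  assumes "x \<in> U" "definable UNIV (\<lambda>s. P (s 0))"
    and step: "\<And>x. x \<in> U \<Longrightarrow> (\<And>z. z \<in> E x \<Longrightarrow> P z) \<Longrightarrow> P x"
  shows "P x"
proof (rule ccontr)
  assume "\<not> P x"
  obtain t where t: "is_transitive M t" "x \<in> E t" using transitive_superset[OF assms(1)] .
  have "t \<in> U" using t by (simp add: is_transitive_def set_U)
  then have "small {z \<in> E t. \<not> P z}" by (intro small_sep definable_not assms)
  then obtain z where "z \<in> E t" "\<not> P z" "E z \<inter> {z \<in> E t. \<not> P z} = {}"
    using foundation[of "as_set {z \<in> E t. \<not> P z}" x] t(2) \<open>\<not> P x\<close> by auto
  moreover have "E z \<subseteq> E t" using t(1) calculation(1) by (simp add: is_transitive_def)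
  ultimately have "P z" using step[OF elts_U[OF \<open>z \<in> E t\<close>]] by blast
  then show False using \<open>\<not> P z\<close> by contradiction
qed


section \<open>Automorphisms extending permutations of the atoms\<close>

lemma atom_not_set: "a \<in> E At \<Longrightarrow> \<not> is_set M a"
  by (simp add: is_set_def)

lemma atom_or_set: "x \<in> U \<Longrightarrow> x \<in> E At \<or> is_set M x"
  by (simp add: is_set_def)

lemma is_fun_rel:
  assumes "is_fun M f X Y"
  shows "app M f x y \<Longrightarrow> x \<in> E X \<and> y \<in> E Y"
    and "app M f x y \<Longrightarrow> app M f x y' \<Longrightarrow> y = y'"
    and "x \<in> E X \<Longrightarrow> \<exists>y\<in>E Y. app M f x y"
proof -
  have 1: "x \<in> E X \<and> y \<in> E Y" if a: "app M f x y" for x y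
  proof -
    have "x \<in> U" "y \<in> U" "opair x y \<in> E f" using a by (auto simp: app_iff)
    moreover then obtain u v where "u \<in> E X" "v \<in> E Y" "is_pair M u v (opair x y)"
      using assms unfolding is_fun_def by blast
    ultimately show ?thesis by (auto simp: is_pair_iff)
  qed
  show "app M f x y \<Longrightarrow> x \<in> E X \<and> y \<in> E Y" by (rule 1)
  show "app M f x y \<Longrightarrow> app M f x y' \<Longrightarrow> y = y'"
    using 1 assms unfolding is_fun_def by blast
  show "x \<in> E X \<Longrightarrow> \<exists>y\<in>E Y. app M f x y"
    using 1 assms unfolding is_fun_def by blast
qed

lemma is_fun_rel_intro:
  assumes "definable UNIV (\<lambda>s. R (s (Suc 0)) (s 0))" "X \<in> U" "Y \<in> U"
    and "\<And>x. x \<in> E X \<Longrightarrow> \<exists>y\<in>E Y. R x y"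
    and "\<And>x y y'. x \<in> E X \<Longrightarrow> y \<in> E Y \<Longrightarrow> y' \<in> E Y \<Longrightarrow> R x y \<Longrightarrow> R x y' \<Longrightarrow> y = y'"
  shows "is_fun M (rel X Y R) X Y"
proof -
  note r = is_set_rel[of R X Y, OF assms(1-3)] elts_rel[of R X Y, OF assms(1-3)]
    app_rel[of R X Y, OF assms(1-3)]
  show ?thesis unfolding is_fun_def r
  proof (intro conjI ballI)
    show "\<exists>u\<in>E X. \<exists>v\<in>E Y. is_pair M u v p" if "p \<in> {opair u v |u v. u \<in> E X \<and> v \<in> E Y \<and> R u v}" for p
      using that elts_U unfolding is_pair_iff by blast
    show "\<exists>!v. u \<in> E X \<and> v \<in> E Y \<and> R u v" if "u \<in> E X" for u
      using assms(4)[OF that] assms(5)[OF that] that by blast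
  qed (rule r(1))
qed

definition bij_rel :: "'u \<Rightarrow> 'u \<Rightarrow> ('u \<Rightarrow> 'u \<Rightarrow> bool) \<Rightarrow> bool" where
  "bij_rel X Y R \<longleftrightarrow> (\<forall>x y. R x y \<longrightarrow> x \<in> E X \<and> y \<in> E Y) \<and>
    (\<forall>x\<in>E X. \<exists>y. R x y) \<and> (\<forall>y\<in>E Y. \<exists>x. R x y) \<and>
    (\<forall>x y y'. R x y \<longrightarrow> R x y' \<longrightarrow> y = y') \<and> (\<forall>x x' y. R x y \<longrightarrow> R x' y \<longrightarrow> x = x')"

lemma bij_relD:
  assumes "bij_rel X Y R"
  shows "R x y \<Longrightarrow> x \<in> E X" "R x y \<Longrightarrow> y \<in> E Y" "x \<in> E X \<Longrightarrow> \<exists>y. R x y" "y \<in> E Y \<Longrightarrow> \<exists>x. R x y"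
    "R x y \<Longrightarrow> R x y' \<Longrightarrow> y = y'" "R x y \<Longrightarrow> R x' y \<Longrightarrow> x = x'"
  using assms[unfolded bij_rel_def] by metis+

lemma bij_rel_conv: "bij_rel X Y R \<Longrightarrow> bij_rel Y X (\<lambda>x y. R y x)"
  unfolding bij_rel_def by (elim conjE, intro conjI; metis)

lemma is_bij_rel: "is_bij M f X Y \<Longrightarrow> bij_rel X Y (app M f)"
  using is_fun_rel[of f X Y] unfolding is_bij_def is_inj_def bij_rel_def
  by (elim conjE, intro conjI; meson)

lemma is_bij_intro:
  assumes "definable UNIV (\<lambda>s. R (s (Suc 0)) (s 0))" "X \<in> U" "Y \<in> U" "bij_rel X Y R"
  shows "is_bij M (rel X Y R) X Y"
proof -
  note R = bij_relD[OF assms(4)]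
  have "is_fun M (rel X Y R) X Y"
    by (rule is_fun_rel_intro) (use assms(1-3) R in blast)+
  moreover have "app M (rel X Y R) u v \<longleftrightarrow> R u v" for u v
    using app_rel[of R X Y, OF assms(1-3)] R(1,2) by blast
  ultimately show ?thesis unfolding is_bij_def is_inj_def using R(4,6) by blast
qed

lemma perm_rel: "is_perm M p \<Longrightarrow> bij_rel At At (app M p)"
  unfolding is_perm_def by (rule is_bij_rel)

lemma perm_U: "is_perm M p \<Longrightarrow> p \<in> U"
  by (simp add: is_perm_def is_bij_def is_inj_def is_fun_def set_U)

lemma perm_conv:
  assumes "is_perm M p"
  shows "\<exists>q. is_perm M q \<and> (\<forall>u v. app M q u v \<longleftrightarrow> app M p v u)"
proof -
  have D: "definable UNIV (\<lambda>s. app M p (s 0) (s (Suc 0)))"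
    by (intro definable_intros var_or_par_const UNIV_I perm_U assms)
  note R = bij_rel_conv[OF perm_rel[OF assms]]
  show ?thesis
  proof (intro exI conjI allI)
    show "is_perm M (rel At At (\<lambda>u v. app M p v u))"
      unfolding is_perm_def using is_bij_intro[of "\<lambda>u v. app M p v u", OF D At_U At_U R] .
    show "app M (rel At At (\<lambda>u v. app M p v u)) u v \<longleftrightarrow> app M p v u" for u v
      using app_rel[of "\<lambda>u v. app M p v u", OF D At_U At_U] bij_relD(1,2)[OF R] by blast
  qed
qed

text \<open>
  A relation \<open>g\<close> is a bisimulation over \<open>p\<close> if it relates atoms only as \<open>p\<close> does, and sets only if each
  member of one is related to some member of the other. The automorphism extending \<open>p\<close> relates \<open>x\<close>
  to \<open>y\<close> precisely if some bisimulation does; this turns the recursion over membership into an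
  existential formula, and inverting \<open>p\<close> into passing to converse relations.
\<close>

definition bisim :: "'u \<Rightarrow> 'u \<Rightarrow> bool" where
  "bisim p g \<longleftrightarrow> (\<forall>u\<in>U. \<forall>v\<in>U. app M g u v \<longrightarrow> app M p u v \<or> is_set M u \<and> is_set M v \<and>
    (\<forall>u'\<in>E u. \<exists>v'\<in>E v. app M g u' v') \<and> (\<forall>v'\<in>E v. \<exists>u'\<in>E u. app M g u' v'))"

definition lift :: "'u \<Rightarrow> 'u \<Rightarrow> 'u \<Rightarrow> bool" where
  "lift p x y \<longleftrightarrow> (\<exists>g\<in>U. bisim p g \<and> app M g x y)"

lemma definable_lift:
  assumes p: "var_or_par C p" and t: "var_or_par C t" and u: "var_or_par C u"
  shows "definable C (\<lambda>s. lift (p s) (t s) (u s))"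
  unfolding lift_def bisim_def
  by (intro definable_intros t[THEN var_or_par_shift] u[THEN var_or_par_shift] p[THEN var_or_par_shift, THEN var_or_par_shift, THEN var_or_par_shift])

lemma lift_U: "lift p x y \<Longrightarrow> x \<in> U \<and> y \<in> U"
  unfolding lift_def using app_U by blast

lemma lift_cases:
  assumes "lift p x y"
  shows "app M p x y \<or> is_set M x \<and> is_set M y \<and>
    (\<forall>u\<in>E x. \<exists>v\<in>E y. lift p u v) \<and> (\<forall>v\<in>E y. \<exists>u\<in>E x. lift p u v)"
proof -
  obtain g where g: "g \<in> U" "bisim p g" "app M g x y" using assms unfolding lift_def by blast
  have "app M g u v \<Longrightarrow> lift p u v" for u v using g unfolding lift_def by blast
  then show ?thesis using g(2,3) app_U[OF g(3)] unfolding bisim_def by meson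
qed

lemma lift_app: "is_perm M p \<Longrightarrow> app M p x y \<Longrightarrow> lift p x y"
  unfolding lift_def bisim_def using perm_U by blast

lemma lift_atom:
  assumes "is_perm M p" "x \<in> E At \<or> y \<in> E At"
  shows "lift p x y \<longleftrightarrow> app M p x y"
  using lift_app[OF assms(1)] lift_cases[of p x y] atom_not_set assms(2) by blast

lemma lift_unique:
  assumes p: "is_perm M p" and "x \<in> U"
  shows "\<forall>y\<in>U. \<forall>y'\<in>U. lift p x y \<longrightarrow> lift p x y' \<longrightarrow> y = y'"
  using assms(2)
proof (induction x rule: eps_induct)
  case definable show ?case by (intro definable_intros definable_lift var_or_par_const UNIV_I perm_U p)
next
  case (step x)
  show ?case
  proof (cases "x \<in> E At")
    case True
    then show ?thesis using lift_atom[OF p] bij_relD(5)[OF perm_rel[OF p]] by blast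
  next
    case False
    have back_forth: "is_set M y \<and> (\<forall>u\<in>E x. \<exists>v\<in>E y. lift p u v) \<and> (\<forall>v\<in>E y. \<exists>u\<in>E x. lift p u v)"
      if "lift p x y" for y
      using lift_cases[OF that] False bij_relD(1)[OF perm_rel[OF p]] by blast
    have "E y \<subseteq> E y'" if h: "lift p x y" "lift p x y'" for y y'
    proof
      fix v assume "v \<in> E y"
      then obtain u where u: "u \<in> E x" "lift p u v" using back_forth[OF h(1)] by blast
      then obtain v' where "v' \<in> E y'" "lift p u v'" using back_forth[OF h(2)] by blast
      then show "v \<in> E y'" using step(2)[OF u(1)] u(2) lift_U by blast
    qed
    then show ?thesis using back_forth extensionality by (meson subset_antisym)
  qed
qed

lemma lift_conv:
  assumes "lift p x y" "\<And>u v. app M q u v \<longleftrightarrow> app M p v u"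
  shows "lift q y x"
proof -
  obtain g where g: "g \<in> U" "bisim p g" "app M g x y" using assms unfolding lift_def by blast
  obtain W where W: "W \<in> U" "\<And>u v. app M g u v \<Longrightarrow> u \<in> E W \<and> v \<in> E W"
    using app_bound[OF g(1)] by blast
  have D: "definable UNIV (\<lambda>s. app M g (s 0) (s (Suc 0)))"
    by (intro definable_intros var_or_par_const UNIV_I g)
  let ?h = "rel W W (\<lambda>u v. app M g v u)"
  have h: "app M ?h u v \<longleftrightarrow> app M g v u" for u v
    using app_rel[of "\<lambda>u v. app M g v u", OF D W(1) W(1)] W(2) by blast
  have "?h \<in> U" using is_set_rel[of "\<lambda>u v. app M g v u", OF D W(1) W(1)] by (rule set_U)
  moreover have "bisim q ?h" using g(2) unfolding bisim_def h assms(2) by blast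
  ultimately show ?thesis unfolding lift_def using g(3) h by blast
qed

text \<open>
  For a set \<open>x\<close>, the image is collected from the images of the members by replacement. To see that
  \<open>x\<close> is related to it, one needs a single bisimulation for all members: the restriction of \<open>lift p\<close>
  to a transitive set \<open>t\<close> containing \<open>x\<close> is one, and it remains one when the new pair is added.
\<close>

lemma lift_total:
  assumes p: "is_perm M p" and "x \<in> U"
  shows "\<exists>y\<in>U. lift p x y"
  using assms(2)
proof (induction x rule: eps_induct)
  case definable show ?case by (intro definable_intros definable_lift var_or_par_const UNIV_I perm_U p)
next
  case (step x)
  have D: "definable UNIV (\<lambda>s. lift p (s 0) (s (Suc 0)))" "definable UNIV (\<lambda>s. lift p (s (Suc 0)) (s 0))"
    by (intro definable_intros definable_lift var_or_par_const UNIV_I perm_U p)+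
  have img: "\<exists>Y. is_set M Y \<and> E Y = {v \<in> U. \<exists>u\<in>E X. lift p u v}" if "X \<in> U" for X
    using small_repl[of "lift p", OF D(1) that] lift_unique[OF p] elts_U unfolding small_def by blast
  show ?case
  proof (cases "x \<in> E At")
    case True
    then obtain y where "app M p x y" using bij_relD(3)[OF perm_rel[OF p]] by blast
    then show ?thesis using lift_app[OF p] lift_U by blast
  next
    case False
    then have x: "is_set M x" using atom_or_set step(1) by blast
    obtain t where t: "is_transitive M t" "x \<in> E t" using transitive_superset[OF step(1)] .
    have "t \<in> U" using t by (simp add: is_transitive_def set_U)
    obtain Y where Y: "is_set M Y" "E Y = {v \<in> U. \<exists>u\<in>E t. lift p u v}" using img[OF \<open>t \<in> U\<close>] by blast
    obtain y where y: "is_set M y" "E y = {v \<in> U. \<exists>u\<in>E x. lift p u v}" using img[OF step(1)] by blast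
    let ?G = "rel t Y (lift p)"
    note G = is_set_rel[of "lift p", OF D(2) \<open>t \<in> U\<close> set_U[OF Y(1)]]
    have G_iff: "app M ?G u v \<longleftrightarrow> u \<in> E t \<and> lift p u v" for u v
      using app_rel[of "lift p", OF D(2) \<open>t \<in> U\<close> set_U[OF Y(1)]] Y(2) lift_U by blast
    let ?g = "as_set (insert (opair x y) (E ?G))"
    have g_iff: "app M ?g u v \<longleftrightarrow> u \<in> E t \<and> lift p u v \<or> u = x \<and> v = y" for u v
      using app_insert[OF step(1) set_U[OF y(1)] set_U[OF G]] G_iff by blast
    have "?g \<in> U" using step(1) set_U[OF y(1)] set_U[OF G] by simp
    have sub: "E u \<subseteq> E t" if "u \<in> E t" for u using t that unfolding is_transitive_def by blast
    have "bisim p ?g"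
      unfolding bisim_def
    proof (intro ballI impI)
      fix u v assume "u \<in> U" "v \<in> U" "app M ?g u v"
      then consider "u \<in> E t" "lift p u v" | "u = x" "v = y" unfolding g_iff by blast
      then show "app M p u v \<or> is_set M u \<and> is_set M v \<and>
        (\<forall>u'\<in>E u. \<exists>v'\<in>E v. app M ?g u' v') \<and> (\<forall>v'\<in>E v. \<exists>u'\<in>E u. app M ?g u' v')"
      proof cases
        case 1
        then show ?thesis using lift_cases[OF 1(2)] sub[OF 1(1)] unfolding g_iff by blast
      next
        case 2
        have "\<forall>u'\<in>E x. \<exists>v'\<in>E y. lift p u' v'" using step(2) y(2) by blast
        moreover have "\<forall>v'\<in>E y. \<exists>u'\<in>E x. lift p u' v'" using y(2) by blast
        ultimately show ?thesis using 2 x y(1) sub[OF t(2)] unfolding g_iff by blast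
      qed
    qed
    moreover have "app M ?g x y" using g_iff by blast
    ultimately have "lift p x y" using \<open>?g \<in> U\<close> lift_def[of p x y] by blast
    then show ?thesis using lift_U by blast
  qed
qed

definition ext_perm :: "'u \<Rightarrow> 'u \<Rightarrow> 'u" where
  "ext_perm p x = (THE y. lift p x y)"

lemma ext_perm_iff:
  assumes "is_perm M p" "x \<in> U"
  shows "ext_perm p x = y \<longleftrightarrow> lift p x y"
proof -
  have "\<exists>!y. lift p x y" using lift_total[OF assms] lift_unique[OF assms] lift_U by blast
  then show ?thesis unfolding ext_perm_def by (metis the1_equality)
qed

lemma ext_perm_elts:
  assumes p: "is_perm M p" and x: "x \<in> U"
  shows "E (ext_perm p x) = ext_perm p ` E x"
proof -
  have l: "lift p x (ext_perm p x)" using ext_perm_iff[OF assms] by blast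
  have u: "lift p u v \<longleftrightarrow> ext_perm p u = v" if "u \<in> E x" for u v
    using ext_perm_iff[OF p elts_U[OF that]] by simp
  consider "app M p x (ext_perm p x)" | "(\<forall>u\<in>E x. \<exists>v\<in>E (ext_perm p x). lift p u v)"
    "(\<forall>v\<in>E (ext_perm p x). \<exists>u\<in>E x. lift p u v)" using lift_cases[OF l] by blast
  then show ?thesis
  proof cases
    case 1
    then show ?thesis using bij_relD(1,2)[OF perm_rel[OF p]] elts_atom by (metis image_empty)
  next
    case 2
    show ?thesis
    proof (intro subset_antisym subsetI)
      show "v \<in> ext_perm p ` E x" if "v \<in> E (ext_perm p x)" for v
        using 2(2) u that by (metis image_eqI)
      show "v \<in> E (ext_perm p x)" if "v \<in> ext_perm p ` E x" for v
        using 2(1) u that by (metis imageE)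
    qed
  qed
qed

lemma ext_perm_bij:
  assumes p: "is_perm M p"
  shows "bij_betw (ext_perm p) U U"
proof -
  obtain q where q: "is_perm M q" "\<And>u v. app M q u v \<longleftrightarrow> app M p v u"
    using perm_conv[OF p] by blast
  have conv: "lift p x y \<longleftrightarrow> lift q y x" for x y
    using lift_conv[of p x y q] lift_conv[of q y x p] q(2) by blast
  show ?thesis
  proof (rule bij_betw_byWitness[where f'="ext_perm q"])
    show "\<forall>x\<in>U. ext_perm q (ext_perm p x) = x"
      using ext_perm_iff[OF p] ext_perm_iff[OF q(1)] conv lift_U by metis
    show "\<forall>x\<in>U. ext_perm p (ext_perm q x) = x"
      using ext_perm_iff[OF p] ext_perm_iff[OF q(1)] conv lift_U by metis
    show "ext_perm p ` U \<subseteq> U" using ext_perm_iff[OF p] lift_U by blast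
    show "ext_perm q ` U \<subseteq> U" using ext_perm_iff[OF q(1)] lift_U by blast
  qed
qed

lemma extends_ext_perm:
  assumes p: "is_perm M p"
  shows "extends_perm M p (ext_perm p)"
  unfolding extends_perm_def is_aut_def
proof (intro conjI ballI)
  have "definable UNIV (\<lambda>s. lift p (s 0) (s (Suc 0)))"
    by (intro definable_intros definable_lift var_or_par_const UNIV_I perm_U p)
  from definable2_formula[of "lift p", OF this] show "definable_fun M (ext_perm p)"
    unfolding definable_fun_def using ext_perm_iff[OF p] by simp
  show bij: "bij_betw (ext_perm p) U U" by (rule ext_perm_bij[OF p])
  show "el M (ext_perm p x) (ext_perm p y) \<longleftrightarrow> el M x y" if "x \<in> U" "y \<in> U" for x y
  proof -
    have "ext_perm p x \<in> U" using bij that(1) by (auto simp: bij_betw_def)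
    then have "el M (ext_perm p x) (ext_perm p y) \<longleftrightarrow> ext_perm p x \<in> ext_perm p ` E y"
      using ext_perm_elts[OF p that(2)] elts_iff by blast
    also have "\<dots> \<longleftrightarrow> x \<in> E y"
      using bij that(1) elts_U by (auto simp: bij_betw_def inj_on_def)
    finally show ?thesis using that(1) elts_iff by blast
  qed
  show "app M p a (ext_perm p a)" if "a \<in> E At" for a
    using lift_atom[OF p] that ext_perm_iff[OF p elts_U[OF that]] by blast
qed

lemma definable_of_definable_fun:
  assumes "definable_fun M h" "i \<noteq> j"
  shows "definable UNIV (\<lambda>s. h (s i) = s j)"
proof -
  obtain \<phi> b where b: "\<forall>i. b i \<in> U" "\<forall>x\<in>U. \<forall>y\<in>U. h x = y \<longleftrightarrow> sat M \<phi> (b(0 := x, 1 := y))"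
    using assms(1) unfolding definable_fun_def by blast
  define r :: "nat \<Rightarrow> nat" where "r k = (if k = 0 then 2 * i else if k = 1 then 2 * j else Suc (2 * k))" for k
  have "2 * k \<noteq> Suc (2 * l)" "Suc (2 * l) \<noteq> 2 * k" for k l :: nat by presburger+
  then have r: "inj r" using assms(2) by (auto simp: inj_def r_def)
  have "mix s b \<circ> r = b(0 := s i, 1 := s j)" for s
    by (auto simp: fun_eq_iff r_def)
  then have "h (s i) = s j \<longleftrightarrow> sat M (rename r \<phi>) (mix s b)" if "env s" for s
    using b(2) that by (simp add: sat_rename[OF r])
  moreover have "\<forall>i. b i \<in> params UNIV" using b(1) by (simp add: params_def)
  ultimately show ?thesis unfolding definable_def by blast
qed

lemma aut_elts:
  assumes "is_aut M h" "x \<in> U"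
  shows "E (h x) = h ` E x"
proof -
  have b: "bij_betw h U U" "\<And>x y. x \<in> U \<Longrightarrow> y \<in> U \<Longrightarrow> el M (h x) (h y) \<longleftrightarrow> el M x y"
    using assms(1) unfolding is_aut_def by auto
  have "z \<in> E (h x) \<longleftrightarrow> z \<in> h ` E x" for z
  proof
    assume z: "z \<in> E (h x)"
    then obtain y where "y \<in> U" "z = h y" using b(1) elts_U unfolding bij_betw_def by blast
    then show "z \<in> h ` E x" using z b(2) assms(2) by (auto simp: elts_iff)
  next
    assume "z \<in> h ` E x"
    then show "z \<in> E (h x)" using b assms(2) unfolding bij_betw_def by (auto simp: elts_iff)
  qed
  then show ?thesis by blast
qed

lemma extends_is_set:
  assumes p: "is_perm M p" and h: "extends_perm M p h" and x: "x \<in> U"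
  shows "is_set M (h x) \<longleftrightarrow> is_set M x"
proof -
  have b: "bij_betw h U U" "\<And>a. a \<in> E At \<Longrightarrow> app M p a (h a)"
    using h unfolding extends_perm_def is_aut_def by auto
  note R = bij_relD[OF perm_rel[OF p]]
  have "h x \<in> E At \<longleftrightarrow> x \<in> E At"
  proof
    assume "h x \<in> E At"
    then obtain a where "app M p a (h x)" using R(4) by blast
    then have "a \<in> E At" "h a = h x" using R(1) R(5) b(2) by blast+
    then show "x \<in> E At" using b(1) x elts_U unfolding bij_betw_def inj_on_def by blast
  next
    show "x \<in> E At \<Longrightarrow> h x \<in> E At" using b(2) R(2) by blast
  qed
  moreover have "h x \<in> U" using b(1) x unfolding bij_betw_def by blast
  ultimately show ?thesis using x by (simp add: is_set_def)
qed

text \<open>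
  Two automorphisms that agree on the atoms agree everywhere by induction over membership. This is the
  place where automorphisms have to be definable.
\<close>

lemma extends_perm_unique:
  assumes p: "is_perm M p" and h: "extends_perm M p h" and k: "extends_perm M p k" and "x \<in> U"
  shows "h x = k x"
proof -
  have aut: "is_aut M h" "is_aut M k" using h k unfolding extends_perm_def by auto
  then have D: "definable_fun M h" "definable_fun M k" unfolding is_aut_def by auto
  have U: "h x \<in> U" "k x \<in> U" if "x \<in> U" for x
    using aut that unfolding is_aut_def bij_betw_def by blast+
  have "\<exists>y\<in>U. h x = y \<and> k x = y" using assms(4)
  proof (induction x rule: eps_induct)
    case definable show ?case by (intro definable_intros definable_of_definable_fun D) simp_all
  next
    case (step x)
    show ?case
    proof (cases "x \<in> E At")
      case True
      then have "app M p x (h x)" "app M p x (k x)" using h k unfolding extends_perm_def by auto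
      then show ?thesis using bij_relD(5)[OF perm_rel[OF p]] app_U by blast
    next
      case False
      then have "is_set M x" using atom_or_set step(1) by blast
      then have "is_set M (h x)" "is_set M (k x)" using extends_is_set p h k step(1) by blast+
      moreover have "E (h x) = E (k x)"
        using aut_elts[OF aut(1) step(1)] aut_elts[OF aut(2) step(1)] step(2) by force
      ultimately show ?thesis using extensionality U[OF step(1)] by blast
    qed
  qed
  then show ?thesis by simp
qed

lemma act_eq_ext_perm:
  assumes "is_perm M p" "x \<in> U"
  shows "act M p x = ext_perm p x"
  unfolding act_def
  by (rule the_equality) (use extends_ext_perm[OF assms(1)] extends_perm_unique[OF assms(1) _ _ assms(2)] in blast)+

lemma act_iff: "is_perm M p \<Longrightarrow> x \<in> U \<Longrightarrow> act M p x = y \<longleftrightarrow> lift p x y"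
  by (simp add: act_eq_ext_perm ext_perm_iff)

lemma act_U [simp]: "is_perm M p \<Longrightarrow> x \<in> U \<Longrightarrow> act M p x \<in> U"
  using act_iff lift_U by blast

lemma act_elts: "is_perm M p \<Longrightarrow> x \<in> U \<Longrightarrow> E (act M p x) = act M p ` E x"
  using act_eq_ext_perm ext_perm_elts elts_U by (metis (no_types, lifting) image_cong)

lemma act_inj: "is_perm M p \<Longrightarrow> x \<in> U \<Longrightarrow> y \<in> U \<Longrightarrow> act M p x = act M p y \<longleftrightarrow> x = y"
  using ext_perm_bij[of p] act_eq_ext_perm unfolding bij_betw_def inj_on_def by metis

lemma act_surj: "is_perm M p \<Longrightarrow> y \<in> U \<Longrightarrow> \<exists>x\<in>U. act M p x = y"
  using ext_perm_bij[of p] act_eq_ext_perm unfolding bij_betw_def by (metis imageE)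

lemma act_atom: "is_perm M p \<Longrightarrow> a \<in> E At \<Longrightarrow> act M p a = b \<longleftrightarrow> app M p a b"
  using act_iff lift_atom elts_U by metis

lemma act_is_set: "is_perm M p \<Longrightarrow> x \<in> U \<Longrightarrow> is_set M (act M p x) \<longleftrightarrow> is_set M x"
  using extends_is_set[OF _ extends_ext_perm] act_eq_ext_perm by metis

lemma act_fixI:
  assumes "is_perm M p" "is_set M x" "\<And>z. z \<in> E x \<Longrightarrow> act M p z = z"
  shows "act M p x = x"
proof (rule extensionality)
  have x: "x \<in> U" using assms(2) by (rule set_U)
  show "is_set M (act M p x)" using act_is_set assms x by blast
  show "E (act M p x) = E x" using act_elts[OF assms(1) x] assms(3) by force
qed (rule assms)

lemma act_At [simp]:
  assumes p: "is_perm M p" shows "act M p At = At"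
proof (rule extensionality)
  note R = bij_relD[OF perm_rel[OF p]]
  show "is_set M (act M p At)" using act_is_set[OF p At_U] by simp
  have "act M p ` E At = E At"
    using act_atom[OF p] R(2,4) R(1) by (auto simp: image_iff) metis+
  then show "E (act M p At) = E At" using act_elts[OF p At_U] by simp
qed simp

lemma nat_is_set: "n \<in> E omega \<Longrightarrow> is_set M n"
  using nat_cases[of n] by auto

lemma act_nat:
  assumes p: "is_perm M p" and n: "n \<in> E omega" shows "act M p n = n"
proof -
  have "n \<in> E omega \<longrightarrow> lift p n n" using omega_U[OF n]
  proof (induction n rule: eps_induct)
    case definable show ?case by (intro definable_intros definable_lift var_or_par_const UNIV_I perm_U p omega_simps)
  next
    case (step x)
    show ?case
    proof
      assume x: "x \<in> E omega"
      have "act M p z = z" if "z \<in> E x" for z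
        using step(2)[OF that] that omega_trans[OF x] act_iff[OF p elts_U[OF that]] by blast
      then have "act M p x = x" by (rule act_fixI[OF p nat_is_set[OF x]])
      then show "lift p x x" using act_iff[OF p step(1)] by simp
    qed
  qed
  then show ?thesis using act_iff[OF p] n by simp
qed


subsection \<open>Invariance of definable predicates\<close>

lemma sat_act:
  assumes p: "is_perm M p"
  shows "env s \<Longrightarrow> sat M \<phi> (\<lambda>i. act M p (s i)) \<longleftrightarrow> sat M \<phi> s"
proof (induction \<phi> arbitrary: s)
  case (FMem i j)
  have "act M p (s i) \<in> act M p ` E (s j) \<longleftrightarrow> s i \<in> E (s j)"
    using act_inj[OF p] elts_U FMem by (auto simp: image_iff)
  then have "act M p (s i) \<in> E (act M p (s j)) \<longleftrightarrow> s i \<in> E (s j)"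
    using act_elts[OF p] FMem by simp
  then show ?case using FMem p by (simp add: elts_iff)
next
  case (FEq i j)
  then show ?case using act_inj[OF p] by simp
next
  case (FAtoms i)
  then show ?case using act_inj[OF p, of "s i" At] act_At[OF p] by simp
next
  case (FAll i \<phi>)
  have "(\<lambda>k. act M p (s k))(i := act M p y) = (\<lambda>k. act M p ((s(i := y)) k))" for y
    by auto
  moreover have "env (s(i := y))" if "y \<in> U" for y
    using FAll.prems that by (simp add: env_def)
  ultimately have "sat M \<phi> ((\<lambda>k. act M p (s k))(i := act M p y)) \<longleftrightarrow> sat M \<phi> (s(i := y))" if "y \<in> U" for y
    using FAll.IH that by presburger
  then show ?case
    using act_surj[OF p] act_U[OF p] by simp metis
qed auto

lemma definable_act:
  assumes "definable C P" and p: "is_perm M p" and C: "\<And>c. c \<in> C \<Longrightarrow> c \<in> U \<Longrightarrow> act M p c = c" and s: "env s"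
  shows "P (\<lambda>i. act M p (s i)) \<longleftrightarrow> P s"
proof -
  obtain \<phi> e where e: "\<forall>i. e i \<in> params C" "\<forall>s. env s \<longrightarrow> P s = sat M \<phi> (mix s e)"
    using assms(1) unfolding definable_def by blast
  have "act M p (e i) = e i" for i
    using C e(1)[rule_format, of i] p by (auto simp: params_def)
  then have m: "(\<lambda>i. act M p (mix s e i)) = mix (\<lambda>i. act M p (s i)) e"
    by (auto simp: mix_def fun_eq_iff)
  have "env (mix s e)" using s e(1) params_U by (auto simp: env_def mix_def)
  moreover have "env (\<lambda>i. act M p (s i))" using s p by (simp add: env_def)
  ultimately show ?thesis using sat_act[OF p, of "mix s e" \<phi>] e(2) s m by simp
qed

lemma act_app:
  assumes p: "is_perm M p" and U: "g \<in> U" "x \<in> U" "y \<in> U"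
  shows "app M (act M p g) (act M p x) (act M p y) \<longleftrightarrow> app M g x y"
proof -
  have "definable {} (\<lambda>s. app M (s 0) (s 1) (s 2))" by (intro definable_intros)
  from definable_act[OF this p, of "(\<lambda>_. g)(1 := x, 2 := y)"] show ?thesis
    using U by (simp add: env_def)
qed

lemma act_opair:
  assumes p: "is_perm M p" and U: "x \<in> U" "y \<in> U"
  shows "act M p (opair x y) = opair (act M p x) (act M p y)"
proof -
  have "definable {} (\<lambda>s. is_pair M (s 0) (s 1) (s 2))" by (intro definable_intros)
  from definable_act[OF this p, of "(\<lambda>_. x)(1 := y, 2 := opair x y)"] show ?thesis
    using U p by (simp add: env_def is_pair_iff)
qed

lemma act_omega:
  assumes p: "is_perm M p" shows "act M p omega = omega"
  by (rule act_fixI[OF p]) (simp_all add: act_nat[OF p])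

text \<open>
  A set defined from the atoms and \<open>\<omega>\<close> alone is fixed by every permutation. This shows at once that
  each of the four sets of the theorem is symmetric with empty support.
\<close>

lemma act_as_set_Collect:
  assumes p: "is_perm M p" and D: "definable {omega} (\<lambda>s. Q (s 0))" and sm: "small {x \<in> U. Q x}"
  shows "act M p (as_set {x \<in> U. Q x}) = as_set {x \<in> U. Q x}"
proof (rule extensionality)
  have Q: "Q (act M p x) \<longleftrightarrow> Q x" if "x \<in> U" for x
    using definable_act[OF D p, of "\<lambda>_. x"] act_omega[OF p] that by (simp add: env_def)
  have "act M p ` {x \<in> U. Q x} = {x \<in> U. Q x}"
  proof (intro subset_antisym subsetI)
    show "y \<in> {x \<in> U. Q x}" if "y \<in> act M p ` {x \<in> U. Q x}" for y
      using that Q p by auto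
    show "y \<in> act M p ` {x \<in> U. Q x}" if y: "y \<in> {x \<in> U. Q x}" for y
    proof -
      obtain x where "x \<in> U" "act M p x = y" using act_surj[OF p] y by blast
      then show ?thesis using y Q by blast
    qed
  qed
  then show "E (act M p (as_set {x \<in> U. Q x})) = E (as_set {x \<in> U. Q x})"
    using act_elts[OF p as_set_U[OF sm]] sm by simp
  show "is_set M (act M p (as_set {x \<in> U. Q x}))" using act_is_set[OF p as_set_U[OF sm]] sm by simp
qed (simp add: sm)

subsection \<open>Transpositions\<close>

text \<open>
  The swap is spelled out as a disjunction, without conditional expressions, so that it is visibly
  definable.
\<close>

definition transp :: "'u \<Rightarrow> 'u \<Rightarrow> 'u" where
  "transp a b = rel At At (\<lambda>u v. u = a \<and> v = b \<or> u = b \<and> v = a \<or> u \<noteq> a \<and> u \<noteq> b \<and> u = v)"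

lemma
  assumes "a \<in> E At" "b \<in> E At"
  shows perm_transp: "is_perm M (transp a b)"
    and act_transp: "z \<in> E At \<Longrightarrow> act M (transp a b) z = (if z = a then b else if z = b then a else z)"
proof -
  define sw where "sw u = (if u = a then b else if u = b then a else u)" for u
  have sw: "sw (sw u) = u" "u \<in> E At \<Longrightarrow> sw u \<in> E At" for u
    using assms by (auto simp: sw_def)
  define R where "R u v \<longleftrightarrow> u \<in> E At \<and> v = sw u" for u v
  have D: "definable UNIV (\<lambda>s. R (s (Suc 0)) (s 0))"
  proof (rule definable_cong)
    show "R (s (Suc 0)) (s 0) \<longleftrightarrow> s (Suc 0) \<in> E At \<and> (s (Suc 0) = a \<and> s 0 = b \<or>
      s (Suc 0) = b \<and> s 0 = a \<or> s (Suc 0) \<noteq> a \<and> s (Suc 0) \<noteq> b \<and> s (Suc 0) = s 0)" for s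
      by (auto simp: R_def sw_def)
  qed (intro definable_intros var_or_par_const UNIV_I elts_U[OF assms(1)] elts_U[OF assms(2)])
  have "bij_rel At At R"
    unfolding bij_rel_def R_def using sw by (intro conjI; metis)
  from is_bij_intro[of R, OF D At_U At_U this] have "is_bij M (rel At At R) At At" .
  moreover have eq: "transp a b = rel At At R"
    unfolding transp_def rel_def R_def by (rule arg_cong[where f=as_set]) (auto simp: sw_def)
  ultimately show p: "is_perm M (transp a b)" by (simp add: is_perm_def)
  show "act M (transp a b) z = (if z = a then b else if z = b then a else z)" if "z \<in> E At"
  proof -
    have "app M (transp a b) z (sw z)"
      unfolding eq app_rel[of R, OF D At_U At_U] using that sw(2) by (simp add: R_def)
    then show ?thesis using act_atom[OF p that] by (simp add: sw_def)
  qed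
qed

lemma act_transp_set:
  assumes ab: "a \<in> E At" "b \<in> E At" and x: "is_set M x" "E x \<subseteq> E At" and "a \<in> E x \<longleftrightarrow> b \<in> E x"
  shows "act M (transp a b) x = x"
proof (rule extensionality)
  note p = perm_transp[OF ab]
  show "is_set M (act M (transp a b) x)" using act_is_set[OF p set_U] x(1) by blast
  have swap: "act M (transp a b) z \<in> E x" "act M (transp a b) (act M (transp a b) z) = z" if "z \<in> E x" for z
    using act_transp[OF ab] that x(2) assms(5) ab by auto
  have "act M (transp a b) ` E x = E x"
  proof (intro subset_antisym subsetI)
    show "z \<in> E x" if "z \<in> act M (transp a b) ` E x" for z using that swap(1) by blast
    show "z \<in> act M (transp a b) ` E x" if "z \<in> E x" for z
      using swap[OF that] by (metis image_eqI)
  qed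
  then show "E (act M (transp a b) x) = E x" using act_elts[OF p set_U[OF x(1)]] by simp
qed (rule x)

subsection \<open>Symmetric and hereditarily symmetric objects\<close>

lemma is_inj_rel:
  assumes "is_inj M f X Y"
  shows "app M f x y \<Longrightarrow> app M f x' y \<Longrightarrow> x = x'" "is_fun M f X Y"
  using assms unfolding is_inj_def by blast+

lemma is_finite_iff: "is_finite M x \<longleftrightarrow> is_set M x \<and> (\<exists>n\<in>E omega. \<exists>g\<in>U. is_bij M g n x)"
proof -
  have "is_bij M g n x \<Longrightarrow> g \<in> U" for g n
    unfolding is_bij_def is_inj_def is_fun_def using set_U by blast
  then show ?thesis unfolding is_finite_def is_nat_iff by blast
qed

lemma definable_is_finite:
  assumes t: "var_or_par C t" and "omega \<in> C" shows "definable C (\<lambda>s. is_finite M (t s))"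
  unfolding is_finite_iff
  by (intro definable_intros t t[THEN var_or_par_shift, THEN var_or_par_shift] var_or_par_const assms(2) omega_simps)

definition symm :: "'u \<Rightarrow> bool" where
  "symm x \<longleftrightarrow> is_symmetric M {p. is_perm M p} x"

lemma symm_iff:
  assumes "x \<in> U"
  shows "symm x \<longleftrightarrow> (\<exists>e\<in>U. is_finite M e \<and> E e \<subseteq> E At \<and>
    (\<forall>p\<in>U. is_perm M p \<longrightarrow> (\<forall>a\<in>E e. lift p a a) \<longrightarrow> lift p x x))"
proof -
  have "fix_grp M {p. is_perm M p} e = {p \<in> U. is_perm M p \<and> (\<forall>a\<in>E e. lift p a a)}" for e
    unfolding fix_grp_def using perm_U act_iff elts_U by blast
  moreover have "sym_grp M {p. is_perm M p} x = {p \<in> U. is_perm M p \<and> lift p x x}"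
    unfolding sym_grp_def using perm_U act_iff assms by blast
  moreover have "is_finite M e \<Longrightarrow> e \<in> U" for e using is_finite_iff set_U by blast
  ultimately show ?thesis unfolding symm_def is_symmetric_def by blast
qed

lemma definable_is_perm:
  assumes t: "var_or_par C t" shows "definable C (\<lambda>s. is_perm M (t s))"
  unfolding is_perm_def by (intro definable_intros t)

lemma definable_symm:
  assumes t: "var_or_par C t" and "omega \<in> C" shows "definable C (\<lambda>s. symm (t s))"
proof (rule definable_cong[OF symm_iff])
  show "t s \<in> U" if "env s" for s by (rule var_or_par_U[OF t that])
qed (intro definable_intros definable_is_finite definable_lift definable_is_perm t t[THEN var_or_par_shift, THEN var_or_par_shift] assms(2))

definition HS :: "'u set" where
  "HS = {x. hereditarily_symmetric M {p. is_perm M p} x}"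

lemma HS_iff: "x \<in> HS \<longleftrightarrow> x \<in> U \<and> (\<forall>z\<in>tc_elts M x. symm z)"
  by (simp add: HS_def hereditarily_symmetric_def symm_def)

lemma HS_U: "x \<in> HS \<Longrightarrow> x \<in> U"
  by (simp add: HS_iff)

lemma HS_symm: "x \<in> HS \<Longrightarrow> symm x"
  unfolding HS_iff tc_elts_def by blast

lemma HS_trans:
  assumes "x \<in> HS" "z \<in> E x" shows "z \<in> HS"
proof -
  have "tc_elts M z \<subseteq> tc_elts M x"
    unfolding tc_elts_def is_transitive_def using assms(2) by blast
  then show ?thesis using assms elts_U unfolding HS_iff by blast
qed

lemma HS_transitiveI:
  assumes "is_transitive M t" "x \<in> E t" "\<And>z. z \<in> E t \<Longrightarrow> symm z"
  shows "x \<in> HS"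
  unfolding HS_iff tc_elts_def using assms elts_U by blast

text \<open>
  The members of the transitive closure of \<open>{x}\<close> are \<open>x\<close> and those of the transitive closures of its
  members, because the latter together with \<open>x\<close> form a transitive set inside any transitive set
  containing \<open>x\<close>.
\<close>

lemma HS_I:
  assumes x: "x \<in> U" and "E x \<subseteq> HS" and "symm x"
  shows "x \<in> HS"
proof -
  obtain t where t: "is_transitive M t" "x \<in> E t" using transitive_superset[OF x] .
  have tU: "t \<in> U" using t(1) set_U unfolding is_transitive_def by blast
  let ?S = "{z \<in> E t. z = x \<or> (\<exists>u\<in>E x. z \<in> tc_elts M u)}"
  have sm: "small ?S"
    by (rule small_sep) (intro definable_intros var_or_par_const UNIV_I x tU)+
  have self: "u \<in> tc_elts M u" if "u \<in> E x" for u
    using elts_U[OF that] unfolding tc_elts_def by blast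
  have down: "w \<in> tc_elts M u" if "z \<in> tc_elts M u" "w \<in> E z" for u z w
    using that elts_U unfolding tc_elts_def is_transitive_def by blast
  have "is_transitive M (as_set ?S)"
    unfolding is_transitive_def
  proof (intro conjI ballI subsetI)
    fix z w assume "z \<in> E (as_set ?S)" "w \<in> E z"
    then have z: "z \<in> E t" "z = x \<or> (\<exists>u\<in>E x. z \<in> tc_elts M u)" using sm by auto
    have "w \<in> E t" using t(1) z(1) \<open>w \<in> E z\<close> unfolding is_transitive_def by blast
    then have "w \<in> ?S" using z(2) \<open>w \<in> E z\<close> self down by blast
    then show "w \<in> E (as_set ?S)" using sm by simp
  qed (simp add: sm)
  moreover have "x \<in> E (as_set ?S)" using sm t by simp
  moreover have "symm z" if "z \<in> E (as_set ?S)" for z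
  proof -
    have "z = x \<or> (\<exists>u\<in>E x. z \<in> tc_elts M u)" using that sm by auto
    then show ?thesis using assms(2,3) HS_iff by blast
  qed
  ultimately show ?thesis by (rule HS_transitiveI)
qed

end

section \<open>Supports in a countable set of atoms\<close>

locale zfa_countable = zfa M for M :: "'u zf_structure" +
  fixes f :: 'u
  assumes enum: "is_bij M f omega At"
begin

lemmas enum_rel = is_bij_rel[OF enum]

lemma f_U: "f \<in> U"
  using enum by (simp add: is_bij_def is_inj_def is_fun_def set_U)

text \<open>
  The image \<open>f[k]\<close> of a natural number under the enumeration of the atoms.
\<close>

definition seg :: "'u \<Rightarrow> 'u set" where
  "seg k = {a \<in> E At. \<exists>j\<in>E k. app M f j a}"

lemma seg_mono: "k \<in> E omega \<Longrightarrow> l \<in> E k \<Longrightarrow> seg l \<subseteq> seg k"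
  using nat_trans[of k] unfolding seg_def by blast

lemma small_seg:
  assumes "k \<in> E omega" shows "small (seg k)"
  unfolding seg_def by (rule small_sep) (intro definable_intros var_or_par_const UNIV_I omega_U assms f_U At_U)+

lemma app_f_seg:
  assumes "app M f j a" "k \<in> E omega" shows "a \<in> seg k \<longleftrightarrow> j \<in> E k"
  using assms bij_relD[OF enum_rel] unfolding seg_def by blast

lemma finite_seg:
  assumes k: "k \<in> E omega" shows "is_finite M (as_set (seg k))"
proof -
  let ?R = "\<lambda>j a. j \<in> E k \<and> app M f j a"
  note sm = small_seg[OF k]
  have "bij_rel k (as_set (seg k)) ?R"
    unfolding bij_rel_def elts_as_set[OF sm]
  proof (intro conjI)
    show "\<forall>x y. x \<in> E k \<and> app M f x y \<longrightarrow> x \<in> E k \<and> y \<in> seg k"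
      using bij_relD(2)[OF enum_rel] unfolding seg_def by blast
    show "\<forall>x\<in>E k. \<exists>y. x \<in> E k \<and> app M f x y"
      using bij_relD(3)[OF enum_rel] omega_trans[OF k] by blast
    show "\<forall>y\<in>seg k. \<exists>x. x \<in> E k \<and> app M f x y" unfolding seg_def by blast
    show "\<forall>x y y'. x \<in> E k \<and> app M f x y \<longrightarrow> x \<in> E k \<and> app M f x y' \<longrightarrow> y = y'"
      using bij_relD(5)[OF enum_rel] by blast
    show "\<forall>x x' y. x \<in> E k \<and> app M f x y \<longrightarrow> x' \<in> E k \<and> app M f x' y \<longrightarrow> x = x'"
      using bij_relD(6)[OF enum_rel] by blast
  qed
  moreover have "definable UNIV (\<lambda>s. s (Suc 0) \<in> E k \<and> app M f (s (Suc 0)) (s 0))"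
    by (intro definable_intros var_or_par_const UNIV_I omega_U k f_U)
  ultimately have "is_bij M (rel k (as_set (seg k)) ?R) k (as_set (seg k))"
    using is_bij_intro[of ?R k "as_set (seg k)"] omega_U[OF k] as_set_U[OF sm] by blast
  then show ?thesis unfolding is_finite_def is_nat_iff using k is_set_as_set[OF sm] by blast
qed

text \<open>
  In the induction step the bound has to cover one more value of \<open>g\<close>, and directedness of the natural
  numbers provides it. The conclusion is stated for initial parts of the domain of one fixed \<open>g\<close>, so
  that the step adds a single argument and leaves \<open>g\<close> alone.
\<close>

lemma image_bounded:
  assumes g: "g \<in> U" and n: "n \<in> E omega" and "\<And>i a a'. app M g i a \<Longrightarrow> app M g i a' \<Longrightarrow> a = a'"
  shows "\<exists>k\<in>E omega. \<forall>i\<in>E n. \<forall>a\<in>E At. app M g i a \<longrightarrow> (\<exists>j\<in>E k. app M f j a)"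
  using n
proof (induction n rule: omega_induct)
  case definable show ?case by (intro definable_intros var_or_par_const UNIV_I g f_U omega_simps)
next
  case zero
  show ?case by (intro bexI[of _ zero]) simp_all
next
  case (suc n)
  then obtain k where k: "k \<in> E omega" "\<forall>i\<in>E n. \<forall>a\<in>E At. app M g i a \<longrightarrow> (\<exists>j\<in>E k. app M f j a)"
    by blast
  show ?case
  proof (cases "\<exists>a\<in>E At. app M g n a")
    case True
    then obtain a where a: "a \<in> E At" "app M g n a" by blast
    then obtain j where j: "app M f j a" using bij_relD(4)[OF enum_rel] by blast
    then have "j \<in> E omega" using bij_relD(1)[OF enum_rel] by blast
    then obtain m where m: "m \<in> E omega" "j \<in> E m" "k \<in> E m" using nat_directed k(1) by blast
    have "E k \<subseteq> E m" using nat_trans[OF m(1)] m(3) by blast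
    have "\<exists>j\<in>E m. app M f j b" if "i \<in> E (suc n)" "b \<in> E At" "app M g i b" for i b
    proof (cases "i = n")
      case True
      then have "b = a" using assms(3)[of n b a] that(3) a(2) by blast
      then show ?thesis using j m(2) by blast
    next
      case False
      then have "i \<in> E n" using that(1) suc_simps(2)[OF omega_U[OF suc(1)]] by blast
      then show ?thesis using k(2) that(2,3) \<open>E k \<subseteq> E m\<close> by blast
    qed
    then show ?thesis using m(1) by blast
  next
    case False
    then show ?thesis using k suc_simps(2)[OF omega_U[OF suc(1)]] by (intro bexI[of _ k]) auto
  qed
qed

lemma seq_bounded:
  assumes "n \<in> E omega" "is_fun M s n At"
  shows "\<exists>k\<in>E omega. \<forall>i a. app M s i a \<longrightarrow> a \<in> seg k"
proof -
  note s = is_fun_rel[OF assms(2)]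
  have "s \<in> U" using assms(2) by (simp add: is_fun_def set_U)
  then obtain k where k: "k \<in> E omega"
    "\<And>i a. i \<in> E n \<Longrightarrow> a \<in> E At \<Longrightarrow> app M s i a \<Longrightarrow> \<exists>j\<in>E k. app M f j a"
    using image_bounded[of s n] assms(1) s(2) by metis
  have "a \<in> seg k" if "app M s i a" for i a
    using s(1)[OF that] k(2)[of i a] that unfolding seg_def by simp
  then show ?thesis using k(1) by blast
qed

lemma is_fun_mono:
  assumes "is_fun M g X Y" "E Y \<subseteq> E Z" shows "is_fun M g X Z"
  using assms(1) assms(2)[THEN subsetD] unfolding is_fun_def by (elim conjE, intro conjI; meson)

lemma is_bij_seq:
  assumes "is_bij M g n x" "E x \<subseteq> E At"
  shows "is_inj M g n At"
  using assms is_fun_mono[of g n x At] unfolding is_bij_def is_inj_def by blast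

lemma finite_bounded:
  assumes "is_finite M x" "E x \<subseteq> E At"
  shows "\<exists>k\<in>E omega. E x \<subseteq> seg k"
proof -
  obtain n g where n: "n \<in> E omega" and g: "is_bij M g n x"
    using assms(1) unfolding is_finite_def is_nat_iff by blast
  have "is_fun M g n At" using is_bij_seq[OF g assms(2)] by (simp add: is_inj_def)
  then obtain k where k: "k \<in> E omega" "\<forall>i a. app M g i a \<longrightarrow> a \<in> seg k"
    using seq_bounded[OF n] by blast
  have "a \<in> seg k" if "a \<in> E x" for a
    using bij_relD(4)[OF is_bij_rel[OF g] that] k(2) by blast
  then show ?thesis using k(1) by blast
qed

text \<open>
  Supports may be enlarged, every finite set of atoms lies in a segment, and segments are finite.
\<close>

lemma symm_seg:
  assumes "x \<in> U"
  shows "symm x \<longleftrightarrow> (\<exists>k\<in>E omega. \<forall>p. is_perm M p \<longrightarrow> (\<forall>a\<in>seg k. act M p a = a) \<longrightarrow> act M p x = x)"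
proof -
  have fx: "act M p z = z \<longleftrightarrow> lift p z z" if "is_perm M p" "z \<in> U" for p z
    using act_iff that by blast
  show ?thesis
  proof
    assume "symm x"
    then obtain e where e: "is_finite M e" "E e \<subseteq> E At"
      "\<And>p. p \<in> U \<Longrightarrow> is_perm M p \<Longrightarrow> \<forall>a\<in>E e. lift p a a \<Longrightarrow> lift p x x"
      unfolding symm_iff[OF assms] by blast
    obtain k where k: "k \<in> E omega" "E e \<subseteq> seg k" using finite_bounded[OF e(1,2)] by blast
    have "act M p x = x" if "is_perm M p" "\<forall>a\<in>seg k. act M p a = a" for p
    proof -
      have "\<forall>a\<in>E e. lift p a a" using that k(2) fx elts_U by blast
      then show ?thesis using e(3)[OF perm_U[OF that(1)] that(1)] fx[OF that(1) assms] by blast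
    qed
    then show "\<exists>k\<in>E omega. \<forall>p. is_perm M p \<longrightarrow> (\<forall>a\<in>seg k. act M p a = a) \<longrightarrow> act M p x = x"
      using k(1) by blast
  next
    assume "\<exists>k\<in>E omega. \<forall>p. is_perm M p \<longrightarrow> (\<forall>a\<in>seg k. act M p a = a) \<longrightarrow> act M p x = x"
    then obtain k where k: "k \<in> E omega"
      "\<And>p. is_perm M p \<Longrightarrow> \<forall>a\<in>seg k. act M p a = a \<Longrightarrow> act M p x = x" by blast
    note sm = small_seg[OF k(1)]
    have sub: "seg k \<subseteq> E At" unfolding seg_def by blast
    have "lift p x x" if "is_perm M p" "\<forall>a\<in>seg k. lift p a a" for p
    proof -
      have "\<forall>a\<in>seg k. act M p a = a" using that sub elts_U fx by blast
      then show ?thesis using k(2)[OF that(1)] fx[OF that(1) assms] by blast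
    qed
    then show "symm x" unfolding symm_iff[OF assms]
      using finite_seg[OF k(1)] sub as_set_U[OF sm] elts_as_set[OF sm] by (intro bexI[of _ "as_set (seg k)"]) auto
  qed
qed

lemma symm_invariant:
  assumes "x \<in> U" "\<And>p. is_perm M p \<Longrightarrow> act M p x = x" shows "symm x"
  unfolding symm_seg[OF assms(1)] using assms(2) omega_simps(3) by blast

lemma seg_singleton:
  assumes "a \<in> E At" shows "\<exists>k\<in>E omega. a \<in> seg k"
proof -
  obtain j where j: "app M f j a" using bij_relD(4)[OF enum_rel assms] by blast
  then have "j \<in> E omega" using bij_relD(1)[OF enum_rel] by blast
  then show ?thesis using j assms unfolding seg_def by (intro bexI[of _ "suc j"]) auto
qed

subsection \<open>Members of the model\<close>

lemma atom_HS: "a \<in> E At \<Longrightarrow> a \<in> HS"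
  by (rule HS_I) (use elts_U elts_atom seg_singleton symm_seg in blast)+

lemma At_HS: "At \<in> HS"
  by (rule HS_I) (auto intro: atom_HS symm_invariant act_At)

lemma nat_HS: "n \<in> E omega \<Longrightarrow> n \<in> HS"
proof (rule HS_transitiveI[of omega])
  show "is_transitive M omega" unfolding is_transitive_def using omega_trans by simp
  show "symm z" if "z \<in> E omega" for z
    by (rule symm_invariant) (use that act_nat in auto)
qed

lemma omega_HS: "omega \<in> HS"
  by (rule HS_I) (auto intro: nat_HS symm_invariant act_omega)

text \<open>
  The sets \<open>{i}\<close>, \<open>{i, a}\<close> and \<open>(i, a)\<close> are all supported by \<open>{a}\<close>, as natural numbers are fixed.
\<close>

lemma opair_HS:
  assumes i: "i \<in> E omega" and a: "a \<in> E At"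
  shows "opair i a \<in> HS"
proof -
  have U: "i \<in> U" "a \<in> U" using i elts_U[OF a] by simp_all
  obtain k where k: "k \<in> E omega" "a \<in> seg k" using seg_singleton[OF a] by blast
  have fix_elts: "symm x" if x: "is_set M x" and "\<And>p z. is_perm M p \<Longrightarrow> act M p a = a \<Longrightarrow> z \<in> E x \<Longrightarrow> act M p z = z" for x
    unfolding symm_seg[OF set_U[OF x]]
    by (rule bexI[OF _ k(1)]) (use act_fixI[OF _ x] that(2) k(2) in blast)
  have 1: "as_set {i} \<in> HS"
    by (rule HS_I) (use U i nat_HS act_nat in \<open>auto intro!: fix_elts\<close>)
  have 2: "as_set {i, a} \<in> HS"
    by (rule HS_I) (use U i a nat_HS atom_HS act_nat in \<open>auto intro!: fix_elts\<close>)
  have "act M p (as_set {i}) = as_set {i}" "act M p (as_set {i, a}) = as_set {i, a}" if "is_perm M p" "act M p a = a" for p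
    using act_fixI[OF that(1), of "as_set {i}"] act_fixI[OF that(1), of "as_set {i, a}"] act_nat[OF that(1) i] that(2) U
    by auto
  then show ?thesis unfolding opair_def
    by (intro HS_I) (use U 1 2 in \<open>auto intro!: fix_elts\<close>)
qed

lemma seq_fix:
  assumes p: "is_perm M p" and s: "is_fun M s n At" and n: "n \<in> E omega"
    and fx: "\<And>i a. app M s i a \<Longrightarrow> act M p a = a"
  shows "act M p s = s"
proof (rule act_fixI[OF p])
  show "is_set M s" using s by (simp add: is_fun_def)
  fix q assume q: "q \<in> E s"
  then obtain i a where ia: "i \<in> E n" "a \<in> E At" "q = opair i a" and U: "i \<in> U" "a \<in> U"
    using s unfolding is_fun_def is_pair_iff by blast
  then have "act M p a = a" using fx[of i a] q by (simp add: app_iff)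
  moreover have "act M p i = i" using act_nat[OF p] omega_trans[OF n] ia(1) by blast
  ultimately show "act M p q = q" using ia(3) act_opair[OF p U] by simp
qed

text \<open>
  A finite sequence is supported by its range, because the natural numbers indexing it are fixed.
\<close>

lemma seq_HS:
  assumes n: "n \<in> E omega" and s: "is_fun M s n At"
  shows "s \<in> HS"
proof (rule HS_I)
  show U: "s \<in> U" using s by (simp add: is_fun_def set_U)
  show "E s \<subseteq> HS"
  proof
    fix q assume "q \<in> E s"
    then obtain i a where "i \<in> E n" "a \<in> E At" "q = opair i a"
      using s unfolding is_fun_def is_pair_iff by blast
    then show "q \<in> HS" using opair_HS omega_trans[OF n] by blast
  qed
  obtain k where "k \<in> E omega" "\<forall>i a. app M s i a \<longrightarrow> a \<in> seg k" using seq_bounded[OF n s] by blast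
  then show "symm s" unfolding symm_seg[OF U] using seq_fix[OF _ s n] by blast
qed

text \<open>
  A finite set of atoms is its own support; a segment containing it serves just as well.
\<close>

lemma finite_HS:
  assumes x: "is_finite M x" "E x \<subseteq> E At" shows "x \<in> HS"
proof (rule HS_I)
  have s: "is_set M x" using x(1) by (simp add: is_finite_def)
  then show U: "x \<in> U" by (rule set_U)
  show "E x \<subseteq> HS" using x(2) atom_HS by blast
  obtain k where "k \<in> E omega" "E x \<subseteq> seg k" using finite_bounded[OF x] by blast
  then show "symm x" unfolding symm_seg[OF U] using act_fixI[OF _ s] by blast
qed

subsection \<open>Absoluteness\<close>

abbreviation "N \<equiv> fraenkel_model M"

lemma univ_N [simp]: "univ N = HS" and el_N [simp]: "el N = el M" and atoms_N [simp]: "atoms N = At"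
  by (simp_all add: fraenkel_model_def permutation_model_def HS_def)

lemma elts_N: "x \<in> HS \<Longrightarrow> elts N x = E x"
proof -
  assume x: "x \<in> HS"
  have "z \<in> HS \<and> el M z x \<longleftrightarrow> z \<in> U \<and> el M z x" for z
  proof
    show "z \<in> U \<and> el M z x" if "z \<in> HS \<and> el M z x" using that HS_U[of z] by blast
    show "z \<in> HS \<and> el M z x" if "z \<in> U \<and> el M z x"
      by (rule conjI[OF HS_trans[OF x iffD2[OF elts_iff that]] conjunct2[OF that]])
  qed
  then show ?thesis by (simp only: elts_def univ_N el_N)
qed

lemma is_set_N: "is_set N x \<longleftrightarrow> x \<in> HS \<and> is_set M x"
  unfolding is_set_def univ_N atoms_N elts_N[OF At_HS] using HS_U[of x] by blast

lemma is_upair_N: "is_upair N a b c \<longleftrightarrow> c \<in> HS \<and> is_upair M a b c"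
  unfolding is_upair_def is_set_N using elts_N[of c] by blast

lemma is_pair_N: "p \<in> HS \<Longrightarrow> is_pair N a b p \<longleftrightarrow> is_pair M a b p"
proof -
  assume p: "p \<in> HS"
  have "c \<in> HS \<and> d \<in> HS" if "is_upair M c d p" for c d
    using that HS_trans[OF p] unfolding is_upair_def by blast
  then show ?thesis unfolding is_pair_def is_upair_N univ_N using p HS_U by meson
qed

lemma app_N: "g \<in> HS \<Longrightarrow> app N g x y \<longleftrightarrow> app M g x y"
  unfolding app_def using elts_N[of g] is_pair_N[OF HS_trans[of g]] by simp

lemma is_fun_N: "X \<in> HS \<Longrightarrow> Y \<in> HS \<Longrightarrow> is_fun N g X Y \<longleftrightarrow> g \<in> HS \<and> is_fun M g X Y"
proof (cases "g \<in> HS")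
  case True
  assume "X \<in> HS" "Y \<in> HS"
  moreover have "app N g = app M g" using app_N[OF True] by (simp add: fun_eq_iff)
  ultimately show ?thesis
    unfolding is_fun_def is_set_N using True elts_N is_pair_N HS_trans[OF True] by simp
qed (simp add: is_fun_def is_set_N)

lemma is_inj_N: "X \<in> HS \<Longrightarrow> Y \<in> HS \<Longrightarrow> is_inj N g X Y \<longleftrightarrow> g \<in> HS \<and> is_inj M g X Y"
  using is_fun_N[of X Y g] app_N[of g] unfolding is_inj_def by (cases "g \<in> HS") simp_all

lemma is_bij_N: "X \<in> HS \<Longrightarrow> Y \<in> HS \<Longrightarrow> is_bij N g X Y \<longleftrightarrow> g \<in> HS \<and> is_bij M g X Y"
  using is_inj_N[of X Y g] app_N[of g] elts_N[of Y] unfolding is_bij_def by (cases "g \<in> HS") simp_all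

lemma is_inductive_N: "is_inductive N w \<longleftrightarrow> w \<in> HS \<and> is_inductive M w"
proof (cases "w \<in> HS")
  case True
  have "is_empty N e \<longleftrightarrow> is_empty M e" if "e \<in> E w" for e
    unfolding is_empty_def is_set_N using elts_N HS_trans[OF True that] by auto
  moreover have "is_succ N n k \<longleftrightarrow> is_succ M n k" if "n \<in> E w" "k \<in> E w" for n k
    unfolding is_succ_def is_set_N using elts_N HS_trans[OF True] that by auto
  ultimately show ?thesis unfolding is_inductive_def is_set_N using True elts_N by auto
qed (simp add: is_inductive_def is_set_N)

text \<open>
  The quantifier over inductive sets ranges over fewer sets in the model, but \<open>\<omega>\<close> is among them.
\<close>

lemma is_omega_N: "is_omega N w \<longleftrightarrow> w = omega"
proof
  assume w: "is_omega N w"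
  then have "w \<in> HS" "is_inductive M w" unfolding is_omega_def is_inductive_N by auto
  moreover have "is_inductive N omega" using omega_HS is_omega_omega by (simp add: is_omega_def is_inductive_N)
  then have "elts N w \<subseteq> elts N omega" using w unfolding is_omega_def by blast
  ultimately have "is_omega M w"
    using is_omega_omega elts_N omega_HS unfolding is_omega_def by (metis subset_trans)
  then show "w = omega" by (simp add: is_omega_iff)
next
  assume "w = omega"
  then show "is_omega N w"
    using is_omega_omega omega_HS elts_N unfolding is_omega_def is_inductive_N by auto
qed

lemma is_nat_N: "is_nat N n \<longleftrightarrow> n \<in> E omega"
  unfolding is_nat_def is_omega_N using elts_N omega_HS by auto

text \<open>
  An enumeration of a finite set of atoms is a finite sequence of atoms, hence belongs to the model.
\<close>

lemma is_finite_N: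
  assumes x: "x \<in> HS" "E x \<subseteq> E At" shows "is_finite N x \<longleftrightarrow> is_finite M x"
proof -
  have "is_bij M g n x \<Longrightarrow> n \<in> E omega \<Longrightarrow> g \<in> HS" for g n
    using seq_HS is_bij_seq[OF _ x(2)] unfolding is_inj_def by blast
  then show ?thesis
    unfolding is_finite_def is_nat_N is_set_N is_nat_iff using is_bij_N nat_HS x by blast
qed

subsection \<open>The four sets\<close>

lemma subset_HS:
  assumes "definable {omega} (\<lambda>s. Q (s 0))" "small {x \<in> U. Q x}" "\<And>x. Q x \<Longrightarrow> x \<in> HS"
  shows "as_set {x \<in> U. Q x} \<in> HS" "E (as_set {x \<in> U. Q x}) = {x. Q x}"
proof -
  show e: "E (as_set {x \<in> U. Q x}) = {x. Q x}" using assms(2,3) HS_U by auto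
  show "as_set {x \<in> U. Q x} \<in> HS"
  proof (rule HS_I)
    show "as_set {x \<in> U. Q x} \<in> U" by (rule as_set_U[OF assms(2)])
    then show "symm (as_set {x \<in> U. Q x})"
      by (rule symm_invariant) (rule act_as_set_Collect[OF _ assms(1,2)])
    show "E (as_set {x \<in> U. Q x}) \<subseteq> HS" unfolding e using assms(3) by blast
  qed
qed

lemma subsets_small:
  assumes "definable {omega} (\<lambda>s. Q (s 0))" "X \<in> U" "\<And>x. Q x \<Longrightarrow> is_set M x \<and> E x \<subseteq> E X"
  shows "small {x \<in> U. Q x}"
proof -
  obtain P where P: "P \<in> U" "E P = {y. is_set M y \<and> E y \<subseteq> E X}"
    using smallE[OF small_Pow[OF assms(2)]] by metis
  obtain \<phi> e where "\<forall>i. e i \<in> params {omega}" "\<forall>s. env s \<longrightarrow> Q (s 0) = sat M \<phi> (mix s e)"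
    using assms(1) unfolding definable_def by blast
  then have "definable UNIV (\<lambda>s. Q (s 0))" unfolding definable_def params_def by (metis Int_UNIV_left Int_iff insert_iff)
  then have "small {x \<in> E P. Q x}" using P(1) by (rule small_sep)
  moreover have "{x \<in> E P. Q x} = {x \<in> U. Q x}" using P(2) assms(3) elts_U set_U by blast
  ultimately show ?thesis by simp
qed

lemma definable_set_HS:
  assumes D: "definable {omega} (\<lambda>s. Q (s 0))" and X: "X \<in> U" "\<And>x. Q x \<Longrightarrow> is_set M x \<and> E x \<subseteq> E X"
    and HS: "\<And>x. Q x \<Longrightarrow> x \<in> HS"
  shows "\<exists>Y\<in>HS. is_set N Y \<and> elts N Y = {x. Q x} \<and> E Y = {x. Q x}"
proof -
  note sm = subsets_small[of Q, OF D X]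
  note Y = subset_HS[of Q, OF D sm HS]
  show ?thesis
    by (rule bexI[OF _ Y(1)]) (simp only: is_set_N elts_N[OF Y(1)] Y is_set_as_set[OF sm] simp_thms)
qed

lemma seqs_bounded:
  "\<exists>X\<in>U. \<forall>n s. n \<in> E omega \<longrightarrow> is_fun M s n At \<longrightarrow> is_set M s \<and> E s \<subseteq> E X"
proof -
  have D: "definable UNIV (\<lambda>s. s 0 = s 0)" by (intro definable_intros)
  have "E s \<subseteq> E (rel omega At (\<lambda>u v. v = v))" if h: "n \<in> E omega" "is_fun M s n At" for n s
  proof
    fix q assume "q \<in> E s"
    then obtain i a where "i \<in> E n" "a \<in> E At" "q = opair i a"
      using h(2) unfolding is_fun_def is_pair_iff by blast
    then show "q \<in> E (rel omega At (\<lambda>u v. v = v))"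
      using elts_rel[of "\<lambda>u v. v = v", OF D omega_simps(2) At_U] omega_trans[OF h(1)] by blast
  qed
  moreover have "rel omega At (\<lambda>u v. v = v) \<in> U"
    using is_set_rel[of "\<lambda>u v. v = v", OF D omega_simps(2) At_U] by (rule set_U)
  moreover have "is_set M s" if "is_fun M s n At" for n s using that unfolding is_fun_def by (rule conjunct1)
  ultimately show ?thesis by blast
qed

lemma Fin_exists: "\<exists>Y\<in>HS. is_Fin N At Y \<and> E Y = {x. is_finite M x \<and> E x \<subseteq> E At}"
proof -
  let ?Q = "\<lambda>x. is_finite M x \<and> E x \<subseteq> E At"
  have D: "definable {omega} (\<lambda>s. ?Q (s 0))" by (intro definable_intros definable_is_finite insertI1)
  have "\<exists>Y\<in>HS. is_set N Y \<and> elts N Y = {x. ?Q x} \<and> E Y = {x. ?Q x}"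
    by (rule definable_set_HS[OF D At_U]) (simp_all add: is_finite_def finite_HS)
  moreover have "is_finite N x \<and> elts N x \<subseteq> elts N At \<longleftrightarrow> ?Q x" for x
  proof (cases "x \<in> HS")
    case True
    then show ?thesis using is_finite_N[OF True] elts_N[OF True] elts_N[OF At_HS] by auto
  next
    case False
    then show ?thesis using finite_HS by (auto simp: is_finite_def[of N] is_set_N)
  qed
  ultimately show ?thesis unfolding is_Fin_def by simp
qed

lemma Pow_exists: "\<exists>Y\<in>HS. is_Pow N At Y \<and> E Y = {x. is_set M x \<and> E x \<subseteq> E At \<and> symm x}"
proof -
  let ?Q = "\<lambda>x. is_set M x \<and> E x \<subseteq> E At \<and> symm x"
  have D: "definable {omega} (\<lambda>s. ?Q (s 0))" by (intro definable_intros definable_symm insertI1)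
  have HS: "x \<in> HS" if "?Q x" for x by (rule HS_I) (use that set_U atom_HS in auto)
  have "\<exists>Y\<in>HS. is_set N Y \<and> elts N Y = {x. ?Q x} \<and> E Y = {x. ?Q x}"
    by (rule definable_set_HS[OF D At_U _ HS]) simp_all
  moreover have "is_set N x \<and> elts N x \<subseteq> elts N At \<longleftrightarrow> ?Q x" for x
  proof (cases "x \<in> HS")
    case True
    then show ?thesis using is_set_N elts_N[OF True] elts_N[OF At_HS] HS_symm[OF True] by simp
  next
    case False
    then show ?thesis using HS[of x] is_set_N by blast
  qed
  ultimately show ?thesis unfolding is_Pow_def by simp
qed

lemma Seq_exists: "\<exists>Y\<in>HS. is_Seq N At Y \<and> E Y = {s. \<exists>n\<in>E omega. is_fun M s n At}"
proof -
  let ?Q = "\<lambda>s. \<exists>n\<in>E omega. is_fun M s n At"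
  have D: "definable {omega} (\<lambda>s. ?Q (s 0))" by (intro definable_intros var_or_par_const insertI1 omega_simps)
  obtain B where B: "B \<in> U" "\<And>n s. n \<in> E omega \<Longrightarrow> is_fun M s n At \<Longrightarrow> is_set M s \<and> E s \<subseteq> E B"
    using seqs_bounded by blast
  have "\<exists>Y\<in>HS. is_set N Y \<and> elts N Y = {x. ?Q x} \<and> E Y = {x. ?Q x}"
    by (rule definable_set_HS[OF D B(1)]) (use B(2) seq_HS in blast)+
  moreover have "(\<exists>n. is_nat N n \<and> is_fun N s n At) \<longleftrightarrow> ?Q s" for s
    using is_nat_N is_fun_N[OF nat_HS At_HS] seq_HS by blast
  ultimately show ?thesis unfolding is_Seq_def by simp
qed

lemma Seq11_exists: "\<exists>Y\<in>HS. is_Seq11 N At Y \<and> E Y = {s. \<exists>n\<in>E omega. is_inj M s n At}"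
proof -
  let ?Q = "\<lambda>s. \<exists>n\<in>E omega. is_inj M s n At"
  have D: "definable {omega} (\<lambda>s. ?Q (s 0))" by (intro definable_intros var_or_par_const insertI1 omega_simps)
  obtain B where B: "B \<in> U" "\<And>n s. n \<in> E omega \<Longrightarrow> is_fun M s n At \<Longrightarrow> is_set M s \<and> E s \<subseteq> E B"
    using seqs_bounded by blast
  have "\<exists>Y\<in>HS. is_set N Y \<and> elts N Y = {x. ?Q x} \<and> E Y = {x. ?Q x}"
    by (rule definable_set_HS[OF D B(1)]) (use B(2) seq_HS is_inj_rel(2) in blast)+
  moreover have "(\<exists>n. is_nat N n \<and> is_inj N s n At) \<longleftrightarrow> ?Q s" for s
    using is_nat_N is_inj_N[OF nat_HS At_HS] seq_HS is_inj_rel(2) by blast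
  ultimately show ?thesis unfolding is_Seq11_def by simp
qed

subsection \<open>Nonexistence of injections\<close>

lemma fresh_atom:
  assumes "j \<in> E omega" "k \<in> E omega" "j \<in> E k \<Longrightarrow> False"
  obtains a where "a \<in> E At" "app M f j a" "a \<notin> seg k"
  using bij_relD(2,3)[OF enum_rel] app_f_seg assms by metis

lemma nat_not_mem_below:
  assumes k: "k \<in> E omega"
  shows "suc k \<notin> E k" "suc (suc k) \<notin> E k" "suc (suc k) \<notin> E (suc k)"
proof -
  have suc: "E (suc k) = insert k (E k)" "E (suc (suc k)) = insert (suc k) (insert k (E k))"
    using omega_U[OF k] by simp_all
  have down: "E m \<subseteq> E k" if "m \<in> E k" for m using nat_trans[OF k] that by blast
  show 1: "suc k \<notin> E k" using down[of "suc k"] suc(1) not_self by blast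
  show 2: "suc (suc k) \<notin> E k" using down[of "suc (suc k)"] suc(2) 1 by blast
  have "suc (suc k) \<noteq> k" using suc(2) 1 by auto
  then show "suc (suc k) \<notin> E (suc k)" using 2 suc(1) by blast
qed

lemma transp_fix_seg:
  assumes "u \<in> E At" "v \<in> E At" "u \<notin> seg k" "v \<notin> seg k" "a \<in> seg k"
  shows "act M (transp u v) a = a"
  using act_transp[OF assms(1,2), of a] assms unfolding seg_def by auto

text \<open>
  With \<open>f[k]\<close> a support of \<open>F\<close>, the finite set \<open>x = f[k + 2]\<close> contains the two unsupported atoms
  \<open>a = f(k)\<close> and \<open>b = f(k + 1)\<close>, and \<open>(a b)\<close> fixes it. So \<open>(a b)\<close> fixes the sequence \<open>F(x)\<close>, which
  therefore cannot have \<open>b\<close> as an entry: at the same index it would also have \<open>a\<close>. An atom \<open>c\<close> beyond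
  everything so far does not occur in \<open>F(x)\<close> either. Thus \<open>(b c)\<close> fixes \<open>F(x)\<close>, and by injectivity it
  fixes \<open>x\<close>, contradicting \<open>b \<in> x\<close> and \<open>c \<notin> x\<close>.
\<close>

lemma no_inj_Fin_Seq:
  assumes F: "F \<in> HS" "is_inj M F X Y"
    and X: "\<And>x. is_finite M x \<Longrightarrow> E x \<subseteq> E At \<Longrightarrow> x \<in> E X"
    and Y: "\<And>y. y \<in> E Y \<Longrightarrow> \<exists>n\<in>E omega. is_fun M y n At"
  shows False
proof -
  note inj = is_inj_rel(1)[OF F(2)] and F_fun = is_fun_rel[OF is_inj_rel(2)[OF F(2)]]
  have FU: "F \<in> U" using F(1) by (rule HS_U)
  obtain k where k: "k \<in> E omega" "\<And>p. is_perm M p \<Longrightarrow> \<forall>a\<in>seg k. act M p a = a \<Longrightarrow> act M p F = F"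
    using HS_symm[OF F(1)] unfolding symm_seg[OF FU] by blast
  let ?l = "suc (suc k)"
  have l: "?l \<in> E omega" using k(1) by simp
  obtain a where a: "a \<in> E At" "app M f k a" "a \<notin> seg k"
    using fresh_atom[OF k(1) k(1)] not_self by blast
  obtain b where b: "b \<in> E At" "app M f (suc k) b" "b \<notin> seg k"
    using fresh_atom[of "suc k" k] k(1) nat_not_mem_below(1) by auto
  have "a \<noteq> b" using a(2) b(2) bij_relD(6)[OF enum_rel, of k a "suc k"] not_self[of k] suc_simps(2)[OF omega_U[OF k(1)]] by auto
  define x where "x = as_set (seg ?l)"
  have x: "is_set M x" "E x = seg ?l" "x \<in> U" using small_seg[OF l] by (simp_all add: x_def)
  have xA: "E x \<subseteq> E At" unfolding x(2) seg_def by blast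
  have "x \<in> E X" using X[of x] finite_seg[OF l] xA unfolding x_def by blast
  then obtain s where s: "app M F x s" "s \<in> E Y" using F_fun(3) by blast
  obtain n where n: "n \<in> E omega" "is_fun M s n At" using Y[OF s(2)] by blast
  have sU: "s \<in> U" using elts_U[OF s(2)] .
  have ab: "a \<in> E x" "b \<in> E x"
    unfolding x(2) using app_f_seg[OF a(2) l] app_f_seg[OF b(2) l] omega_U[OF k(1)] by auto
  note p = perm_transp[OF a(1) b(1)]
  have "act M (transp a b) F = F" using k(2)[OF p] transp_fix_seg[OF a(1) b(1) a(3) b(3)] by blast
  moreover have "act M (transp a b) x = x" using act_transp_set[OF a(1) b(1) x(1) xA] ab by blast
  ultimately have "app M F x (act M (transp a b) s)"
    using act_app[OF p FU x(3) sU] s(1) by simp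
  then have ps: "act M (transp a b) s = s" using s(1) F_fun(2) by blast
  have bs: "\<not> app M s i b" for i
  proof
    assume i: "app M s i b"
    then have "i \<in> E n" using is_fun_rel(1)[OF n(2)] by blast
    then have "i \<in> E omega" using omega_trans[OF n(1)] by blast
    then have "app M s i (act M (transp a b) b)"
      using act_app[OF p sU, of i b] i ps act_nat[OF p] elts_U[OF b(1)] by simp
    then have "app M s i a" using act_transp[OF a(1) b(1) b(1)] by (simp split: if_splits)
    then show False using is_fun_rel(2)[OF n(2)] i \<open>a \<noteq> b\<close> by blast
  qed
  obtain r where r: "r \<in> E omega" "\<forall>i z. app M s i z \<longrightarrow> z \<in> seg r" using seq_bounded[OF n] by blast
  \<comment> \<open>The atom \<open>c = f(m)\<close> lies outside \<open>f[m]\<close>, which covers \<open>f[k]\<close>, \<open>x\<close> and the range of \<open>s\<close>.\<close>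
  obtain m where m: "m \<in> E omega" "r \<in> E m" "?l \<in> E m" using nat_directed[OF r(1) l] by blast
  obtain c where c: "c \<in> E At" "app M f m c" "c \<notin> seg m"
    using fresh_atom[OF m(1) m(1)] not_self by blast
  have cr: "c \<notin> seg r" "c \<notin> seg ?l" using seg_mono[OF m(1)] m(2,3) c(3) by blast+
  have ck: "c \<notin> seg k" using cr(2) seg_mono[OF l, of k] omega_U[OF k(1)] by auto
  note q = perm_transp[OF b(1) c(1)]
  have "act M (transp b c) F = F" using k(2)[OF q] transp_fix_seg[OF b(1) c(1) b(3) ck] by blast
  moreover have "act M (transp b c) s = s"
  proof (rule seq_fix[OF q n(2,1)])
    show "act M (transp b c) z = z" if "app M s i z" for i z
      using that bs r(2) cr(1) act_transp[OF b(1) c(1), of z] is_fun_rel(1)[OF n(2) that] by auto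
  qed
  ultimately have "app M F (act M (transp b c) x) s"
    using act_app[OF q FU x(3) sU] s(1) by simp
  then have "act M (transp b c) x = x" using inj s(1) by blast
  moreover have "act M (transp b c) b \<in> E (act M (transp b c) x)"
    using act_elts[OF q x(3)] ab(2) by blast
  ultimately have "c \<in> E x" using act_transp[OF b(1) c(1) b(1)] by simp
  then show False using cr(2) x(2) by blast
qed

text \<open>
  With \<open>f[k]\<close> a support of \<open>F\<close>, let \<open>s\<close> be the restriction of \<open>f\<close> to \<open>k + 3\<close>. Among its three
  unsupported entries, at the indices \<open>k\<close>, \<open>k + 1\<close> and \<open>k + 2\<close>, two agree on membership in the set
  \<open>F(s)\<close>. Swapping these two fixes \<open>F(s)\<close>, hence \<open>s\<close> by injectivity, although the sequence changes at
  their indices.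
\<close>

lemma no_inj_Seq11_Pow:
  assumes F: "F \<in> HS" "is_inj M F X Y"
    and X: "\<And>s n. n \<in> E omega \<Longrightarrow> is_inj M s n At \<Longrightarrow> s \<in> E X"
    and Y: "\<And>y. y \<in> E Y \<Longrightarrow> is_set M y \<and> E y \<subseteq> E At"
  shows False
proof -
  note inj = is_inj_rel(1)[OF F(2)] and F_fun = is_fun_rel[OF is_inj_rel(2)[OF F(2)]]
  have FU: "F \<in> U" using F(1) by (rule HS_U)
  obtain k where k: "k \<in> E omega" "\<And>p. is_perm M p \<Longrightarrow> \<forall>a\<in>seg k. act M p a = a \<Longrightarrow> act M p F = F"
    using HS_symm[OF F(1)] unfolding symm_seg[OF FU] by blast
  let ?n = "suc (suc (suc k))"
  have n: "?n \<in> E omega" using k(1) by simp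
  define s where "s = rel ?n At (\<lambda>i a. app M f i a)"
  have D: "definable UNIV (\<lambda>s. app M f (s (Suc 0)) (s 0))" by (intro definable_intros var_or_par_const UNIV_I f_U)
  have "is_fun M s ?n At"
    unfolding s_def
  proof (rule is_fun_rel_intro[of "app M f", OF D omega_U[OF n] At_U])
    show "\<exists>a\<in>E At. app M f i a" if "i \<in> E ?n" for i
      using bij_relD(2,3)[OF enum_rel] omega_trans[OF n] that by blast
    show "a = b" if "app M f i a" "app M f i b" for i a b
      using bij_relD(5)[OF enum_rel that] .
  qed
  moreover have s_iff: "app M s i a \<longleftrightarrow> i \<in> E ?n \<and> app M f i a" for i a
    unfolding s_def using app_rel[of "app M f", OF D omega_U[OF n] At_U] bij_relD(2)[OF enum_rel] by blast
  ultimately have s: "is_inj M s ?n At"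
    unfolding is_inj_def using bij_relD(6)[OF enum_rel] by blast
  obtain x where x: "app M F s x" "x \<in> E Y" using F_fun(3)[OF X[OF n s]] by blast
  have U: "s \<in> U" "x \<in> U" using app_U[OF x(1)] by auto
  have x_set: "is_set M x" "E x \<subseteq> E At" using Y[OF x(2)] by auto
  have no_swap: False
    if uv: "u \<noteq> v" "app M s i u" "app M s j v" "i \<notin> E k" "j \<notin> E k" "u \<in> E x \<longleftrightarrow> v \<in> E x" for u v i j
  proof -
    have ij: "app M f i u" "app M f j v" "i \<in> E omega" "j \<in> E omega"
      using uv(2,3) bij_relD(1)[OF enum_rel] unfolding s_iff by blast+
    have A: "u \<in> E At" "v \<in> E At" using ij(1,2) bij_relD(2)[OF enum_rel] by blast+
    have "u \<notin> seg k" "v \<notin> seg k" using app_f_seg[OF ij(1) k(1)] app_f_seg[OF ij(2) k(1)] uv(4,5) by auto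
    note p = perm_transp[OF A]
    have "act M (transp u v) F = F"
      using k(2)[OF p] transp_fix_seg[OF A \<open>u \<notin> seg k\<close> \<open>v \<notin> seg k\<close>] by blast
    moreover have "act M (transp u v) x = x" using act_transp_set[OF A x_set uv(6)] .
    ultimately have "app M F (act M (transp u v) s) x" using act_app[OF p FU U] x(1) by simp
    then have "act M (transp u v) s = s" using inj x(1) by blast
    then have "app M s i (act M (transp u v) u)"
      using act_app[OF p U(1), of i u] uv(2) act_nat[OF p ij(3)] omega_U[OF ij(3)] elts_U[OF A(1)] by simp
    then have "app M s i v" using act_transp[OF A A(1)] by simp
    then show False using uv(1,2) bij_relD(5)[OF enum_rel] unfolding s_iff by blast
  qed
  have idx: "k \<in> E ?n" "suc k \<in> E ?n" "suc (suc k) \<in> E ?n" using omega_U[OF k(1)] by auto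
  note notin = not_self[of k] nat_not_mem_below[OF k(1)]
  have dist: "k \<noteq> suc k" "k \<noteq> suc (suc k)" "suc k \<noteq> suc (suc k)"
    using notin omega_U[OF k(1)] by (metis insertI1 suc_simps(2) suc_simps(3) insertCI)+
  obtain a where a: "app M s k a" using is_fun_rel(3)[OF is_inj_rel(2)[OF s] idx(1)] by blast
  obtain b where b: "app M s (suc k) b" using is_fun_rel(3)[OF is_inj_rel(2)[OF s] idx(2)] by blast
  obtain c where c: "app M s (suc (suc k)) c" using is_fun_rel(3)[OF is_inj_rel(2)[OF s] idx(3)] by blast
  have neq: "a \<noteq> b" "a \<noteq> c" "b \<noteq> c" using is_inj_rel(1)[OF s] a b c dist by blast+
  consider "a \<in> E x \<longleftrightarrow> b \<in> E x" | "a \<in> E x \<longleftrightarrow> c \<in> E x" | "b \<in> E x \<longleftrightarrow> c \<in> E x" by blast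
  then show False
    using no_swap[OF neq(1) a b] no_swap[OF neq(2) a c] no_swap[OF neq(3) b c] notin by cases blast+
qed

end

theorem proposition7p1p3:
  fixes M :: "'u zf_structure"
  assumes "ZFA_AC M"
    and "is_countably_infinite M (atoms M)"
  shows "\<exists>FinA Seq11A SeqA PowA.
    is_Fin (fraenkel_model M) (atoms M) FinA \<and>
    is_Seq11 (fraenkel_model M) (atoms M) Seq11A \<and>
    is_Seq (fraenkel_model M) (atoms M) SeqA \<and>
    is_Pow (fraenkel_model M) (atoms M) PowA \<and>
    card_incomparable (fraenkel_model M) FinA Seq11A \<and>
    card_incomparable (fraenkel_model M) FinA SeqA \<and>
    card_incomparable (fraenkel_model M) Seq11A PowA \<and>
    card_incomparable (fraenkel_model M) SeqA PowA"
proof -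
  interpret zfa M by unfold_locales (rule assms(1))
  obtain f where "is_bij M f omega (atoms M)"
    using assms(2) unfolding is_countably_infinite_def is_omega_iff by blast
  then interpret zfa_countable M f by unfold_locales
  obtain Fi where Fi: "Fi \<in> HS" "is_Fin N At Fi" "E Fi = {x. is_finite M x \<and> E x \<subseteq> E At}"
    using Fin_exists by blast
  obtain S1 where S1: "S1 \<in> HS" "is_Seq11 N At S1" "E S1 = {s. \<exists>n\<in>E omega. is_inj M s n At}"
    using Seq11_exists by blast
  obtain S where S: "S \<in> HS" "is_Seq N At S" "E S = {s. \<exists>n\<in>E omega. is_fun M s n At}"
    using Seq_exists by blast
  obtain P where P: "P \<in> HS" "is_Pow N At P" "E P = {x. is_set M x \<and> E x \<subseteq> E At \<and> symm x}"
    using Pow_exists by blast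
  have FP: "E Fi \<subseteq> E P"
    unfolding Fi(3) P(3) using finite_HS HS_symm by (auto simp: is_finite_def)
  have SS: "E S1 \<subseteq> E S" using S(3) S1(3) unfolding is_inj_def by blast
  have down: "\<not> card_le N X Y"
    if "X \<in> HS" "Y \<in> HS" "E Fi \<subseteq> E X" "E Y \<subseteq> E S" for X Y
    unfolding card_le_def is_inj_N[OF that(1,2)]
    using no_inj_Fin_Seq[of _ X Y] that(3,4) Fi(3) S(3) by blast
  have up: "\<not> card_le N X Y"
    if "X \<in> HS" "Y \<in> HS" "E S1 \<subseteq> E X" "\<forall>x\<in>E Y. is_set M x \<and> E x \<subseteq> E At" for X Y
    unfolding card_le_def is_inj_N[OF that(1,2)]
    using no_inj_Seq11_Pow[of _ X Y] that(3,4) S1(3) by blast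
  have sets: "\<forall>x\<in>E P. is_set M x \<and> E x \<subseteq> E At" "\<forall>x\<in>E Fi. is_set M x \<and> E x \<subseteq> E At"
    unfolding P(3) Fi(3) is_finite_def by blast+
  have "card_incomparable N Fi S1" "card_incomparable N Fi S"
    "card_incomparable N S1 P" "card_incomparable N S P"
    unfolding card_incomparable_def
    using down[OF Fi(1) S1(1) subset_refl SS] up[OF S1(1) Fi(1) subset_refl sets(2)]
      down[OF Fi(1) S(1) subset_refl subset_refl] up[OF S(1) Fi(1) SS sets(2)]
      down[OF P(1) S1(1) FP SS] up[OF S1(1) P(1) subset_refl sets(1)]
      down[OF P(1) S(1) FP subset_refl] up[OF S(1) P(1) SS sets(1)]
    by simp_all
  then show ?thesis using Fi(2) S1(2) S(2) P(2) by blast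
qed

end
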